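(* Let $k$ be any field, let $G$ be a (finite) tree, let $Q$ be the standard graded polynomial ring over $k$ whose variables are the vertices of $G$, let $I_G\subseteq Q$ be the edge ideal of $G$, and let $R=Q/I_G$. Then the Koszul homology algebra $H(R)$ is generated as a $k$-algebra by $\bigoplus_i H_i(R)_{i+1}$.
   Context: A tree is a simple graph (no loops, no multiple edges) that is connected and contains no cycle. The edge ideal of a simple graph $G$ on vertices $x_1,\dots,x_n$ is the ideal $I_G=(x_ix_j \mid x_ix_j \text{ is an edge of } G)$ of $Q=k[x_1,\dots,x_n]$. $H(R)$ denotes the homology of the Koszul complex $K(x_1,\dots,x_n;R)$ on (the images in $R$ of) all the variables of $Q$, i.e. the exterior algebra over $R$ on generators $dx_1,\dots,dx_n$ with differential determined by $dx_i\mapsto x_i$; it is a differential graded algebra, so $H(R)$ is a $k$-algebra. It is bigraded, $H(R)=\bigoplus_{i,j}H_i(R)_j$, where $i$ is the homological degree and $j$ is the internal degree induced by the grading of $R$ (with each $dx_i$ of homological degree $1$ and internal degree $1$). The subspace $\bigoplus_i H_i(R)_{i+1}$ is called the lowest linear strand. *)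

theory Defs
  imports
    "HOL-Library.Poly_Mapping"
    "HOL-Algebra.QuotRing"
    "HOL-Algebra.Generated_Rings"
    "Graph_Theory.Digraph_Component"
begin

section \<open>Trees\<close>

text \<open>
  A finite simple graph is a \<^locale>\<open>pair_graph\<close>: a finite, loop-free, symmetric digraph without
  parallel arcs. The predicate \<open>tree\<close> of the graph library is not usable here: in a symmetric
  digraph every edge yields the closed walk \<open>u, v, u\<close>, which the library counts as a cycle.
  A cycle of a simple graph is a library cycle of length at least 3.
\<close>

definition simple_tree :: "'v pair_pre_digraph \<Rightarrow> bool" where
  "simple_tree G \<longleftrightarrow>
     pair_graph G \<and> Digraph_Component.connected (with_proj G) \<and>
     \<not> (\<exists>p. pre_digraph.cycle (with_proj G) p \<and> 3 \<le> length p)"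


section \<open>Polynomial rings and edge ideals\<close>

text \<open>
  A monomial is a finitely supported exponent vector, a polynomial a finitely supported family
  of coefficients indexed by monomials; the product of polynomials is convolution.
\<close>

type_synonym ('v, 'k) mpoly = "('v \<Rightarrow>\<^sub>0 nat) \<Rightarrow>\<^sub>0 'k"

definition mpoly_const :: "'k \<Rightarrow> ('v, 'k::comm_ring_1) mpoly" where
  "mpoly_const c = Poly_Mapping.single 0 c"

definition mpoly_var :: "'v \<Rightarrow> ('v, 'k::comm_ring_1) mpoly" where
  "mpoly_var v = Poly_Mapping.single (Poly_Mapping.single v 1) 1"

definition mpoly_ring :: "'v set \<Rightarrow> ('v, 'k::comm_ring_1) mpoly ring" where
  "mpoly_ring V =
     \<lparr>carrier = {p. \<forall>m \<in> Poly_Mapping.keys p. Poly_Mapping.keys m \<subseteq> V},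
      monoid.mult = (*), one = 1, ring.zero = 0, add = (+)\<rparr>"

definition monomial_degree :: "('v \<Rightarrow>\<^sub>0 nat) \<Rightarrow> nat" where
  "monomial_degree m = (\<Sum>v \<in> Poly_Mapping.keys m. Poly_Mapping.lookup m v)"

definition mpoly_part :: "'v set \<Rightarrow> nat \<Rightarrow> ('v, 'k::comm_ring_1) mpoly set" where
  "mpoly_part V j =
     {p \<in> carrier (mpoly_ring V). \<forall>m \<in> Poly_Mapping.keys p. monomial_degree m = j}"

definition edge_ideal :: "'v pair_pre_digraph \<Rightarrow> ('v, 'k::comm_ring_1) mpoly set" where
  "edge_ideal G =
     Idl\<^bsub>mpoly_ring (pverts G)\<^esub> {mpoly_var u * mpoly_var v | u v. (u, v) \<in> parcs G}"

definition edge_ring :: "'v pair_pre_digraph \<Rightarrow> ('v, 'k::comm_ring_1) mpoly set ring" where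
  "edge_ring G = mpoly_ring (pverts G) Quot edge_ideal G"

definition edge_class ::
  "'v pair_pre_digraph \<Rightarrow> ('v, 'k::comm_ring_1) mpoly \<Rightarrow> ('v, 'k) mpoly set" where
  "edge_class G p = edge_ideal G +>\<^bsub>mpoly_ring (pverts G)\<^esub> p"

definition edge_ring_part ::
  "'v pair_pre_digraph \<Rightarrow> nat \<Rightarrow> ('v, 'k::comm_ring_1) mpoly set set" where
  "edge_ring_part G j = edge_class G ` mpoly_part (pverts G) j"


section \<open>The Koszul complex as a differential graded algebra\<close>

text \<open>
  The exterior algebra over \<open>R\<close> on generators \<open>dx\<^sub>v\<close> (\<open>v \<in> V\<close>, with \<open>V\<close> finite and linearly ordered)
  is free over \<open>R\<close> on the products \<open>dx\<^sub>S = dx\<^bsub>s\<^sub>1\<^esub> \<dots> dx\<^bsub>s\<^sub>p\<^esub>\<close> with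
  \<open>S = {s\<^sub>1 < \<dots> < s\<^sub>p} \<subseteq> V\<close>. An element is represented by its coefficient function \<open>S \<mapsto> f S\<close> on \<open>Pow V\<close>.
  For disjoint \<open>S\<close>, \<open>T\<close> one has \<open>dx\<^sub>S dx\<^sub>T = (-1)\<^sup>n dx\<^bsub>S \<union> T\<^esub>\<close>, where \<open>n\<close> is the number of
  inversions between \<open>S\<close> and \<open>T\<close>; otherwise the product is \<open>0\<close>.
\<close>

definition inversions :: "'v::linorder set \<Rightarrow> 'v set \<Rightarrow> nat" where
  "inversions S T = card {(s, t). s \<in> S \<and> t \<in> T \<and> t < s}"

definition koszul_sign :: "('r, 'm) ring_scheme \<Rightarrow> 'v::linorder set \<Rightarrow> 'v set \<Rightarrow> 'r" where
  "koszul_sign R S T = (\<ominus>\<^bsub>R\<^esub> \<one>\<^bsub>R\<^esub>) [^]\<^bsub>R\<^esub> inversions S T"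

definition koszul_const :: "('r, 'm) ring_scheme \<Rightarrow> 'v set \<Rightarrow> 'r \<Rightarrow> 'v set \<Rightarrow> 'r" where
  "koszul_const R V r = (\<lambda>U \<in> Pow V. if U = {} then r else \<zero>\<^bsub>R\<^esub>)"

definition koszul_algebra ::
  "('r, 'm) ring_scheme \<Rightarrow> 'v::linorder set \<Rightarrow> ('v set \<Rightarrow> 'r) ring" where
  "koszul_algebra R V =
     \<lparr>carrier = Pow V \<rightarrow>\<^sub>E carrier R,
      monoid.mult = (\<lambda>f g. \<lambda>U \<in> Pow V.
        \<Oplus>\<^bsub>R\<^esub>S \<in> Pow U. koszul_sign R S (U - S) \<otimes>\<^bsub>R\<^esub> (f S \<otimes>\<^bsub>R\<^esub> g (U - S))),
      one = koszul_const R V \<one>\<^bsub>R\<^esub>,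
      ring.zero = koszul_const R V \<zero>\<^bsub>R\<^esub>,
      add = (\<lambda>f g. \<lambda>U \<in> Pow V. f U \<oplus>\<^bsub>R\<^esub> g U)\<rparr>"

text \<open>
  The \<open>R\<close>-linear antiderivation with \<open>dx\<^sub>v \<mapsto> x v\<close> sends \<open>dx\<^sub>S\<close> to the sum over \<open>v \<in> S\<close> of
  \<open>(-1)\<^sup>n x v dx\<^bsub>S - {v}\<^esub>\<close>, where \<open>n\<close> is the number of elements of \<open>S\<close> below \<open>v\<close>. Below, its
  coefficient at \<open>dx\<^sub>U\<close> collects the contributions of \<open>S = insert v U\<close>.
\<close>

definition koszul_diff ::
  "('r, 'm) ring_scheme \<Rightarrow> 'v::linorder set \<Rightarrow> ('v \<Rightarrow> 'r) \<Rightarrow> ('v set \<Rightarrow> 'r) \<Rightarrow> ('v set \<Rightarrow> 'r)" where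
  "koszul_diff R V x f = (\<lambda>U \<in> Pow V.
     \<Oplus>\<^bsub>R\<^esub>v \<in> V - U. koszul_sign R {v} U \<otimes>\<^bsub>R\<^esub> (x v \<otimes>\<^bsub>R\<^esub> f (insert v U)))"

definition koszul_cycles ::
  "('r, 'm) ring_scheme \<Rightarrow> 'v::linorder set \<Rightarrow> ('v \<Rightarrow> 'r) \<Rightarrow> ('v set \<Rightarrow> 'r) set" where
  "koszul_cycles R V x =
     {f \<in> carrier (koszul_algebra R V). koszul_diff R V x f = \<zero>\<^bsub>koszul_algebra R V\<^esub>}"

definition koszul_boundaries ::
  "('r, 'm) ring_scheme \<Rightarrow> 'v::linorder set \<Rightarrow> ('v \<Rightarrow> 'r) \<Rightarrow> ('v set \<Rightarrow> 'r) set" where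
  "koszul_boundaries R V x = koszul_diff R V x ` carrier (koszul_algebra R V)"

definition koszul_homology ::
  "('r, 'm) ring_scheme \<Rightarrow> 'v::linorder set \<Rightarrow> ('v \<Rightarrow> 'r) \<Rightarrow> ('v set \<Rightarrow> 'r) set ring" where
  "koszul_homology R V x =
     (koszul_algebra R V)\<lparr>carrier := koszul_cycles R V x\<rparr> Quot koszul_boundaries R V x"

definition koszul_class ::
  "('r, 'm) ring_scheme \<Rightarrow> 'v::linorder set \<Rightarrow> ('v \<Rightarrow> 'r) \<Rightarrow> ('v set \<Rightarrow> 'r) \<Rightarrow> ('v set \<Rightarrow> 'r) set" where
  "koszul_class R V x f = koszul_boundaries R V x +>\<^bsub>koszul_algebra R V\<^esub> f"

text \<open>
  \<open>Rj\<close> is the grading of \<open>R\<close>. As \<open>dx\<^sub>S\<close> has homological and internal degree \<open>card S\<close>, the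
  coefficient of \<open>dx\<^sub>S\<close> in an element of bidegree \<open>(i, j)\<close> has degree \<open>j - i\<close> in \<open>R\<close>, and vanishes
  if \<open>j < i\<close>.
\<close>

definition koszul_part ::
  "('r, 'm) ring_scheme \<Rightarrow> (nat \<Rightarrow> 'r set) \<Rightarrow> 'v::linorder set \<Rightarrow> nat \<Rightarrow> nat \<Rightarrow> ('v set \<Rightarrow> 'r) set" where
  "koszul_part R Rj V i j =
     {f \<in> carrier (koszul_algebra R V). \<forall>S \<in> Pow V.
        f S \<in> (if card S = i \<and> i \<le> j then Rj (j - i) else {\<zero>\<^bsub>R\<^esub>})}"

definition koszul_homology_part ::
  "('r, 'm) ring_scheme \<Rightarrow> (nat \<Rightarrow> 'r set) \<Rightarrow> 'v::linorder set \<Rightarrow> ('v \<Rightarrow> 'r) \<Rightarrow> nat \<Rightarrow> nat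
     \<Rightarrow> ('v set \<Rightarrow> 'r) set set" where
  "koszul_homology_part R Rj V x i j =
     koszul_class R V x ` (koszul_cycles R V x \<inter> koszul_part R Rj V i j)"

text \<open>The homology vanishes in homological degrees above \<open>card V\<close>, so the sum over all \<open>i\<close> is finite.\<close>

definition linear_strand ::
  "('r, 'm) ring_scheme \<Rightarrow> (nat \<Rightarrow> 'r set) \<Rightarrow> 'v::linorder set \<Rightarrow> ('v \<Rightarrow> 'r)
     \<Rightarrow> ('v set \<Rightarrow> 'r) set set" where
  "linear_strand R Rj V x =
     {\<Oplus>\<^bsub>koszul_homology R V x\<^esub>i \<in> {..card V}. h i | h.
        h \<in> (\<Pi> i \<in> {..card V}. koszul_homology_part R Rj V x i (i + 1))}"


section \<open>The Koszul homology algebra of an edge ring\<close>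

definition edge_koszul_homology ::
  "'v::linorder pair_pre_digraph \<Rightarrow> ('v set \<Rightarrow> ('v, 'k::comm_ring_1) mpoly set) set ring" where
  "edge_koszul_homology G =
     koszul_homology (edge_ring G) (pverts G) (\<lambda>v. edge_class G (mpoly_var v))"

definition edge_linear_strand ::
  "'v::linorder pair_pre_digraph \<Rightarrow> ('v set \<Rightarrow> ('v, 'k::comm_ring_1) mpoly set) set set" where
  "edge_linear_strand G =
     linear_strand (edge_ring G) (edge_ring_part G) (pverts G) (\<lambda>v. edge_class G (mpoly_var v))"

text \<open>The structure map of the \<open>k\<close>-algebra \<^term>\<open>edge_koszul_homology G\<close>.\<close>

definition edge_scalar ::
  "'v::linorder pair_pre_digraph \<Rightarrow> 'k::comm_ring_1 \<Rightarrow> ('v set \<Rightarrow> ('v, 'k) mpoly set) set" where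
  "edge_scalar G c =
     koszul_class (edge_ring G) (pverts G) (\<lambda>v. edge_class G (mpoly_var v))
       (koszul_const (edge_ring G) (pverts G) (edge_class G (mpoly_const c)))"

text \<open>
  The subalgebra generated by \<open>S\<close> of an algebra \<open>A\<close> with structure map \<open>\<phi>\<close> is the subring generated
  by \<open>S\<close> and the scalars. (The locale \<open>subalgebra\<close> of HOL-Algebra does not require closure under
  multiplication.)
\<close>

definition generated_algebra :: "('a, 'm) ring_scheme \<Rightarrow> ('k \<Rightarrow> 'a) \<Rightarrow> 'a set \<Rightarrow> 'a set" where
  "generated_algebra A \<phi> S = generate_ring A (range \<phi> \<union> S)"

end

theory Submission
  imports Defs
begin

text \<open>
  The part of multidegree \<open>\<alpha>\<close> of the Koszul complex of \<open>R\<close> has the basis \<open>x\<^bsup>\<alpha> - S\<^esup> dx\<^sub>S\<close>, where \<open>S\<close>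
  runs through the subsets of \<open>W = supp \<alpha>\<close> for which \<open>supp (\<alpha> - S)\<close> is independent. If
  \<open>\<alpha> v \<ge> 2\<close> for some \<open>v\<close>, or if some \<open>v \<in> W\<close> has no neighbour in \<open>W\<close>, then adding \<open>v\<close> to \<open>S\<close> is a
  contracting homotopy. Otherwise \<open>\<alpha>\<close> is squarefree and the forest induced on \<open>W\<close> has a leaf \<open>v\<close>,
  with neighbour \<open>u\<close>. The same homotopy, restricted to the sets \<open>S\<close> containing \<open>u\<close>, makes every cycle
  homologous to one supported on sets \<open>S\<close> with \<open>u \<notin> S\<close>. Such an \<open>S\<close> contains the set \<open>N\<close> of all
  neighbours of \<open>u\<close> in \<open>W\<close>, so the cycle is the product of the star cycle \<open>x\<^sub>u dx\<^sub>N\<close> and a cycle of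
  multidegree \<open>W - N - {u}\<close>. By induction the homology is spanned by products of star cycles, and
  these lie in the lowest linear strand.
\<close>

section \<open>Leaves of forests\<close>


definition independent_verts :: "'v pair_pre_digraph \<Rightarrow> 'v set \<Rightarrow> bool" where
  "independent_verts G T \<longleftrightarrow> (\<forall>a\<in>T. \<forall>b\<in>T. (a, b) \<notin> parcs G)"

lemma independent_verts_subset:
  "independent_verts G T \<Longrightarrow> S \<subseteq> T \<Longrightarrow> independent_verts G S"
  by (auto simp: independent_verts_def)

text \<open>Passes from vertex lists, on which the longest-path argument runs, to arc lists, in
  terms of which cycles are defined: \<open>zip (x # vs) vs\<close> lists the arcs between
  successive vertices.\<close>

lemma pawalk_of_successive:
  assumes "successively (\<lambda>a b. (a, b) \<in> E) (x # vs)"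
  shows "pcas x (zip (x # vs) vs) (last (x # vs))"
    and "pawalk_verts x (zip (x # vs) vs) = x # vs"
    and "set (zip (x # vs) vs) \<subseteq> E"
  using assms by (induction vs arbitrary: x) auto

text \<open>Longest-path argument: if every vertex of W had two neighbours in W, the first vertex of
  a longest path in W would have a neighbour other than the second vertex. By maximality this
  neighbour lies on the path and closes a cycle. The conclusion also admits a vertex with no
  neighbour in W.\<close>

lemma forest_has_leaf:
  assumes G: "pair_graph G"
    and acyc: "\<not> (\<exists>p. pre_digraph.cycle (with_proj G) p \<and> 3 \<le> length p)"
    and W: "W \<subseteq> pverts G" "W \<noteq> {}"
  obtains v where "v \<in> W"
    and "\<And>a b. a \<in> W \<Longrightarrow> b \<in> W \<Longrightarrow> (v, a) \<in> parcs G \<Longrightarrow> (v, b) \<in> parcs G \<Longrightarrow> a = b"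
proof (rule ccontr)
  interpret pair_graph G by fact
  assume "\<not> thesis"
  with that have two: "\<exists>a\<in>W. \<exists>b\<in>W. a \<noteq> b \<and> (v, a) \<in> parcs G \<and> (v, b) \<in> parcs G" if "v \<in> W" for v
    using \<open>v \<in> W\<close> by metis
  have finW: "finite W"
    using W(1) pair_finite_verts finite_subset by blast
  define P where "P xs \<longleftrightarrow> xs \<noteq> [] \<and> distinct xs \<and> set xs \<subseteq> W \<and>
    successively (\<lambda>a b. (a, b) \<in> parcs G) xs" for xs
  obtain w where "w \<in> W" using W(2) by blast
  then have "P [w]" by (simp add: P_def)
  moreover have "\<forall>xs. P xs \<longrightarrow> length xs < Suc (card W)"
    unfolding P_def by (metis card_mono distinct_card finW le_imp_less_Suc)
  ultimately obtain xs where xs: "P xs" and maxl: "\<And>ys. P ys \<Longrightarrow> length ys \<le> length xs"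
    using ex_has_greatest_nat[of P "[w]" length "Suc (card W)"] by blast
  then obtain x0 rest where xs_eq: "xs = x0 # rest"
    unfolding P_def by (cases xs) auto
  have x0: "x0 \<in> W" using xs xs_eq by (auto simp: P_def)
  obtain c where c: "c \<in> W" "(x0, c) \<in> parcs G" "rest \<noteq> [] \<Longrightarrow> c \<noteq> hd rest"
    using two[OF x0] by metis
  have cx0: "(c, x0) \<in> parcs G"
    using c(2) graph_symmetric by blast
  have "c \<noteq> x0" using c(2) pair_no_loops by fastforce
  have "c \<in> set xs"
  proof (rule ccontr)
    assume "c \<notin> set xs"
    then have "P (c # xs)"
      using xs c(1) cx0 by (auto simp: P_def xs_eq)
    from maxl[OF this] show False by simp
  qed
  then have "c \<in> set rest" using \<open>c \<noteq> x0\<close> xs_eq by auto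
  then obtain ys zs where rest: "rest = ys @ c # zs"
    by (meson split_list)
  have "ys \<noteq> []" using c(3) rest by (cases ys) auto
  \<comment> \<open>The closed walk is c, x0, \<open>ys\<close>, c: it follows the path from x0 to
    c, and the arc from c to x0 closes it. As c is not the second vertex, \<open>ys\<close> is
    nonempty and the walk has at least three arcs, so it is not an edge traversed back and
    forth.\<close>
  define vs where "vs = x0 # ys @ [c]"
  have succ: "successively (\<lambda>a b. (a, b) \<in> parcs G) (c # vs)" and dist: "distinct vs"
    using xs cx0 unfolding P_def xs_eq rest vs_def
    by (auto simp: successively_append_iff successively_Cons hd_append split: if_splits)
  let ?p = "zip (c # vs) vs"
  note walk = pawalk_of_successive[OF succ]
  have "awalk c ?p c"
    unfolding awalk_def using walk c(1) W(1) by (auto simp: vs_def)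
  moreover have "distinct (tl (pawalk_verts c ?p))"
    using walk(2) dist by simp
  moreover have "3 \<le> length ?p"
    using \<open>ys \<noteq> []\<close> by (cases ys) (auto simp: vs_def)
  ultimately have "cycle ?p"
    unfolding cycle_def by (metis length_0_conv not_numeral_le_zero)
  with acyc \<open>3 \<le> length ?p\<close> show False by blast
qed

section \<open>The Koszul complex over a commutative ring type\<close>

text \<open>
  Type-class counterparts of \<^const>\<open>koszul_sign\<close>, the product of \<^const>\<open>koszul_algebra\<close> and
  \<^const>\<open>koszul_diff\<close>. They are applied to polynomial representatives of chains over the edge ring, and,
  with \<open>x = 1\<close>, to the coefficients of chains of a fixed multidegree.
\<close>

definition ksign :: "'v::linorder set \<Rightarrow> 'v set \<Rightarrow> 'a::comm_ring_1" where
  "ksign S T = (- 1) ^ inversions S T"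

definition kmul :: "('v::linorder set \<Rightarrow> 'a::comm_ring_1) \<Rightarrow> ('v set \<Rightarrow> 'a) \<Rightarrow> 'v set \<Rightarrow> 'a" where
  "kmul f g U = (\<Sum>S\<in>Pow U. ksign S (U - S) * (f S * g (U - S)))"

definition kdiff :: "'v::linorder set \<Rightarrow> ('v \<Rightarrow> 'a::comm_ring_1) \<Rightarrow> ('v set \<Rightarrow> 'a) \<Rightarrow> 'v set \<Rightarrow> 'a" where
  "kdiff V x f U = (\<Sum>v\<in>V - U. ksign {v} U * (x v * f (insert v U)))"

section \<open>Signs of products in the exterior algebra\<close>

lemma finite_inversions:
  "finite S \<Longrightarrow> finite T \<Longrightarrow> finite {(s, t). s \<in> S \<and> t \<in> T \<and> t < s}"
  by (rule finite_subset[of _ "S \<times> T"]) auto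

text \<open>Inversions against T are counted separately for the two disjoint sets, and the power of
  -1 turns the sum of the counts into a product.\<close>

lemma ksign_Un_left:
  assumes "finite S" "finite S'" "finite T" "S \<inter> S' = {}"
  shows "ksign (S \<union> S') T = ksign S T * ksign S' T"
proof -
  have "{(s, t). s \<in> S \<union> S' \<and> t \<in> T \<and> t < s} =
      {(s, t). s \<in> S \<and> t \<in> T \<and> t < s} \<union> {(s, t). s \<in> S' \<and> t \<in> T \<and> t < s}" by auto
  then have "inversions (S \<union> S') T = inversions S T + inversions S' T"
    unfolding inversions_def using assms
    by (simp add: card_Un_disjoint[OF finite_inversions finite_inversions] disjoint_iff)
  then show ?thesis by (simp add: ksign_def power_add)
qed

lemma ksign_Un_right:
  assumes "finite S" "finite T" "finite T'" "T \<inter> T' = {}"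
  shows "ksign S (T \<union> T') = ksign S T * ksign S T'"
proof -
  have "{(s, t). s \<in> S \<and> t \<in> T \<union> T' \<and> t < s} =
      {(s, t). s \<in> S \<and> t \<in> T \<and> t < s} \<union> {(s, t). s \<in> S \<and> t \<in> T' \<and> t < s}" by auto
  then have "inversions S (T \<union> T') = inversions S T + inversions S T'"
    unfolding inversions_def using assms
    by (simp add: card_Un_disjoint[OF finite_inversions finite_inversions] disjoint_iff)
  then show ?thesis by (simp add: ksign_def power_add)
qed

text \<open>Each pair in the product of S and T is an inversion for exactly one of the two orders,
  so the two inversion numbers add up to \<open>card S * card T\<close>. This is graded
  commutativity.\<close>

lemma ksign_swap:
  assumes "finite S" "finite T" "S \<inter> T = {}"
  shows "ksign S T * ksign T S = (- 1) ^ (card S * card T)"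
proof -
  let ?A = "{(s, t). s \<in> S \<and> t \<in> T \<and> t < s}" and ?B = "{(s, t). s \<in> T \<and> t \<in> S \<and> t < s}"
  have "S \<times> T = ?A \<union> prod.swap ` ?B"
    using assms(3) by (auto simp: image_iff)
  moreover have "?A \<inter> prod.swap ` ?B = {}" by auto
  ultimately have "card (S \<times> T) = card ?A + card (prod.swap ` ?B)"
    using assms by (simp only: card_Un_disjoint finite_inversions finite_imageI)
  then have "card S * card T = inversions S T + inversions T S"
    by (simp add: inversions_def card_image card_cartesian_product)
  then show ?thesis by (simp add: ksign_def power_add)
qed

lemma ksign_square [simp]: "ksign S T * ksign S T = 1"
  by (simp add: ksign_def flip: power_mult_distrib)

lemma ksign_square_left [simp]: "ksign S T * (ksign S T * a) = a"
  by (simp flip: mult.assoc)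

lemma ksign_empty [simp]: "ksign {} T = 1" "ksign S {} = 1"
  by (auto simp: ksign_def inversions_def)

lemma ksign_insert_left:
  "finite S \<Longrightarrow> finite T \<Longrightarrow> v \<notin> S \<Longrightarrow> ksign (insert v S) T = ksign {v} T * ksign S T"
  using ksign_Un_left[of "{v}" S T] by simp

lemma ksign_insert_right:
  "finite S \<Longrightarrow> finite T \<Longrightarrow> v \<notin> T \<Longrightarrow> ksign S (insert v T) = ksign S {v} * ksign S T"
  using ksign_Un_right[of S "{v}" T] by simp

lemma ksign_singletons: "v \<noteq> w \<Longrightarrow> ksign {v} {w} = - ksign {w} {v}"
proof -
  assume "v \<noteq> w"
  then have "ksign {v} {w} * ksign {w} {v} = (- 1 :: 'b::comm_ring_1)"
    using ksign_swap[of "{v}" "{w}"] by simp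
  then have "ksign {v} {w} * (ksign {w} {v} * ksign {w} {v}) = (- 1 :: 'b) * ksign {w} {v}"
    by (simp only: flip: mult.assoc)
  then show ?thesis by simp
qed

lemma ksign_swap_singleton:
  assumes "finite S" "v \<notin> S"
  shows "ksign S {v} * ksign {v} S = (- 1) ^ card S"
  using ksign_swap[of S "{v}"] assms by simp

section \<open>Product and differential: square zero, Leibniz rule, contraction\<close>

lemma kmul_cong:
  "(\<And>S. S \<subseteq> U \<Longrightarrow> f S = f' S) \<Longrightarrow> (\<And>S. S \<subseteq> U \<Longrightarrow> g S = g' S) \<Longrightarrow> kmul f g U = kmul f' g' U"
  unfolding kmul_def by (intro sum.cong) auto

lemma kmul_add_left: "kmul (\<lambda>S. f S + f' S) g U = kmul f g U + kmul f' g U"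
  by (simp add: kmul_def algebra_simps sum.distrib)

lemma kmul_add_right: "kmul f (\<lambda>S. g S + g' S) U = kmul f g U + kmul f g' U"
  by (simp add: kmul_def algebra_simps sum.distrib)

lemma kdiff_add: "kdiff V x (\<lambda>S. f S + g S) U = kdiff V x f U + kdiff V x g U"
  by (simp add: kdiff_def algebra_simps sum.distrib)

lemma kdiff_minus: "kdiff V x (\<lambda>S. - f S) U = - kdiff V x f U"
  by (simp add: kdiff_def sum_negf)

lemma kdiff_diff: "kdiff V x (\<lambda>S. f S - g S) U = kdiff V x f U - kdiff V x g U"
  by (simp add: kdiff_def algebra_simps sum_subtractf)

lemma kdiff_zero [simp]: "kdiff V x (\<lambda>S. 0) U = 0"
  by (simp add: kdiff_def)

text \<open>The double sum runs over ordered pairs of distinct v, w outside U. Exchanging v and w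
  keeps the value of f and flips the sign, so the pairs with v < w cancel those with w < v.\<close>

lemma kdiff_kdiff:
  assumes fin: "finite V" "finite U"
  shows "kdiff V x (kdiff V x f) U = 0"
proof -
  define F where "F = (\<lambda>(v, w). ksign {v} U * (x v * (ksign {w} (insert v U) * (x w * f (insert w (insert v U))))))"
  define D where "D = {(v, w). v \<in> V - U \<and> w \<in> V - U \<and> v \<noteq> w}"
  define D1 where "D1 = {(v, w). v \<in> V - U \<and> w \<in> V - U \<and> v < w}"
  define D2 where "D2 = {(v, w). v \<in> V - U \<and> w \<in> V - U \<and> w < v}"
  have D: "D = D1 \<union> D2" "D1 \<inter> D2 = {}" by (auto simp: D_def D1_def D2_def)
  have finD: "finite D1" "finite D2"
    by (rule finite_subset[of _ "V \<times> V"], use fin in \<open>auto simp: D1_def D2_def\<close>)+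
  have "kdiff V x (kdiff V x f) U = (\<Sum>v\<in>V - U. \<Sum>w\<in>V - insert v U. F (v, w))"
    unfolding kdiff_def F_def by (simp add: sum_distrib_left)
  also have "\<dots> = sum F (SIGMA v : V - U. V - insert v U)"
    using fin by (simp add: sum.Sigma)
  also have "(SIGMA v : V - U. V - insert v U) = D" by (auto simp: D_def)
  also have "sum F D = sum F D1 + sum F D2"
    using D finD by (simp add: sum.union_disjoint)
  also have "sum F D2 = sum (\<lambda>p. - F p) D1"
  proof (rule sum.reindex_bij_witness[where i = prod.swap and j = prod.swap], goal_cases)
    case (5 p)
    then obtain v w where p: "p = (v, w)" "v \<noteq> w" "v \<notin> U" "w \<notin> U" by (auto simp: D2_def)
    have "(ksign {v} {w} :: 'b) = - ksign {w} {v}" using p(2) by (rule ksign_singletons)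
    then show ?case
      using p fin by (simp add: F_def ksign_insert_right[where T = U] insert_commute algebra_simps)
  qed (auto simp: D1_def D2_def)
  finally show ?thesis by (simp add: sum_negf)
qed

lemma sum_Pow_insert:
  assumes "finite U" "v \<notin> U"
  shows "sum h (Pow (insert v U)) = sum h (Pow U) + (\<Sum>S\<in>Pow U. h (insert v S))"
proof -
  have inj: "inj_on (insert v) (Pow U)"
    using assms(2) by (auto simp: inj_on_def)
  have "sum h (Pow (insert v U)) = sum h (Pow U) + sum h (insert v ` Pow U)"
    unfolding Pow_insert using assms by (intro sum.union_disjoint) auto
  then show ?thesis by (simp add: sum.reindex[OF inj])
qed

text \<open>The graded Leibniz rule; \<open>(- 1) ^ card S\<close> is the sign of moving the
  differential past dx_S.\<close>

lemma kdiff_kmul: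
  assumes V: "finite V" and U: "U \<subseteq> V"
  shows "kdiff V x (kmul f g) U =
    kmul (kdiff V x f) g U + kmul (\<lambda>S. (- 1) ^ card S * f S) (kdiff V x g) U"
proof -
  have finU: "finite U" using V U finite_subset by blast
  note fin = finU finite_subset[OF _ finU]
  \<comment> \<open>In \<open>P S v\<close> the differential removes v from the index set of f, in
    \<open>Q S v\<close> from that of g. For v outside U these terms make up the left-hand side; the
    right-hand side has further terms with v in U.\<close>
  define P where "P S v = ksign S (U - S) * (ksign {v} S * (x v * f (insert v S)) * g (U - S))" for S v
  define Q where "Q S v = ksign S (U - S) * ((- 1) ^ card S * f S *
      (ksign {v} (U - S) * (x v * g (insert v (U - S)))))" for S v
  have 1: "kmul (kdiff V x f) g U = (\<Sum>S\<in>Pow U. \<Sum>v\<in>V - S. P S v)"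
    unfolding kmul_def kdiff_def P_def by (simp add: sum_distrib_left sum_distrib_right)
  have 1: "kmul (kdiff V x f) g U = (\<Sum>S\<in>Pow U. \<Sum>v\<in>V - U. P S v) + (\<Sum>S\<in>Pow U. \<Sum>v\<in>U - S. P S v)"
    unfolding 1 sum.distrib[symmetric]
  proof (rule sum.cong[OF refl])
    fix S assume "S \<in> Pow U"
    then have "V - S = (V - U) \<union> (U - S)" using U by auto
    then show "(\<Sum>v\<in>V - S. P S v) = (\<Sum>v\<in>V - U. P S v) + (\<Sum>v\<in>U - S. P S v)"
      using V finU by (simp add: sum.union_disjoint Int_Diff disjoint_iff)
  qed
  have 2: "kmul (\<lambda>S. (- 1) ^ card S * f S) (kdiff V x g) U = (\<Sum>S\<in>Pow U. \<Sum>v\<in>V - (U - S). Q S v)"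
    unfolding kmul_def kdiff_def Q_def by (simp add: sum_distrib_left)
  have 2: "kmul (\<lambda>S. (- 1) ^ card S * f S) (kdiff V x g) U =
      (\<Sum>S\<in>Pow U. \<Sum>v\<in>V - U. Q S v) + (\<Sum>S\<in>Pow U. \<Sum>v\<in>S. Q S v)"
    unfolding 2 sum.distrib[symmetric]
  proof (rule sum.cong[OF refl])
    fix S assume "S \<in> Pow U"
    then have "V - (U - S) = (V - U) \<union> S" "(V - U) \<inter> S = {}" "finite S" using U fin by auto
    then show "(\<Sum>v\<in>V - (U - S). Q S v) = (\<Sum>v\<in>V - U. Q S v) + (\<Sum>v\<in>S. Q S v)"
      using V by (simp add: sum.union_disjoint)
  qed
  \<comment> \<open>In the surplus terms v belongs to the index sets of both f and g. Sending (S, v)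
    to \<open>(insert v S, v)\<close> matches them: both then carry the same values of f and g, with
    opposite signs.\<close>
  have cancel: "(\<Sum>S\<in>Pow U. \<Sum>v\<in>U - S. P S v) = - (\<Sum>S\<in>Pow U. \<Sum>v\<in>S. Q S v)"
  proof -
    have "(\<Sum>S\<in>Pow U. \<Sum>v\<in>U - S. P S v) = sum (\<lambda>(S, v). P S v) (SIGMA S : Pow U. U - S)"
      using finU by (intro sum.Sigma) auto
    also have "\<dots> = sum (\<lambda>(S, v). - Q S v) (SIGMA S : Pow U. S)"
    proof (rule sum.reindex_bij_witness[where i = "\<lambda>(S, v). (S - {v}, v)" and j = "\<lambda>(S, v). (insert v S, v)"],
        goal_cases)
      case (5 p)
      then obtain S v where p: "p = (S, v)" "S \<subseteq> U" "v \<in> U" "v \<notin> S" by auto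
      define T where "T = U - insert v S"
      have US: "U - S = insert v T" "v \<notin> T"
        using p by (auto simp: T_def)
      have f: "finite S" "finite T" using p fin by (auto simp: T_def)
      have s: "(ksign S {v} * ksign {v} S :: 'b) = (- 1) ^ card S"
        using f p by (simp add: ksign_swap_singleton)
      have "P S v = (ksign S {v} * ksign {v} S) * (ksign S T * (x v * (f (insert v S) * g (insert v T))))"
        unfolding P_def US using f US by (simp add: ksign_insert_right[where T = T] mult_ac)
      moreover have "Q (insert v S) v = - ((- 1) ^ card S * ((ksign {v} T * ksign {v} T) *
          (ksign S T * (x v * (f (insert v S) * g (insert v T))))))"
        unfolding Q_def T_def[symmetric] using f p by (simp add: ksign_insert_left[where S = S] mult_ac)
      ultimately show ?case by (simp add: p s)
    qed auto
    also have "\<dots> = - (\<Sum>S\<in>Pow U. \<Sum>v\<in>S. Q S v)"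
      using fin by (simp add: sum.Sigma sum_negf case_prod_unfold)
    finally show ?thesis .
  qed
  have "kdiff V x (kmul f g) U = (\<Sum>v\<in>V - U. \<Sum>S\<in>Pow U. P S v + Q S v)"
    unfolding kdiff_def
  proof (rule sum.cong[OF refl])
    fix v assume v: "v \<in> V - U"
    then have "v \<notin> U" by simp
    have "ksign {v} U * (x v * kmul f g (insert v U)) =
        (\<Sum>S\<in>Pow (insert v U). ksign {v} U * (x v * (ksign S (insert v U - S) * (f S * g (insert v U - S)))))"
      unfolding kmul_def by (simp add: sum_distrib_left)
    \<comment> \<open>The subsets of \<open>insert v U\<close> are split by whether they contain v:
      those without v leave it to the right factor and give Q, those with v give P.\<close>
    also have "\<dots> = (\<Sum>S\<in>Pow U.
        ksign {v} U * (x v * (ksign S (insert v U - S) * (f S * g (insert v U - S)))) +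
        ksign {v} U * (x v * (ksign (insert v S) (insert v U - insert v S) *
            (f (insert v S) * g (insert v U - insert v S)))))"
      by (subst sum_Pow_insert[OF finU \<open>v \<notin> U\<close>]) (simp only: sum.distrib)
    also have "\<dots> = (\<Sum>S\<in>Pow U. P S v + Q S v)"
    proof (rule sum.cong[OF refl])
      fix S assume S: "S \<in> Pow U"
      define T where "T = U - S"
      have T: "insert v U - S = insert v T" "insert v U - insert v S = T" "U = S \<union> T" "S \<inter> T = {}"
        "v \<notin> S" "v \<notin> T" "finite S" "finite T"
        using S v fin by (auto simp: T_def)
      have s: "((- 1) ^ card S :: 'b) = ksign S {v} * ksign {v} S"
        using T by (simp add: ksign_swap_singleton)
      have "ksign {v} U = (ksign {v} S * ksign {v} T :: 'b)"
        using T by (simp add: ksign_Un_right)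
      then show "ksign {v} U * (x v * (ksign S (insert v U - S) * (f S * g (insert v U - S)))) +
          ksign {v} U * (x v * (ksign (insert v S) (insert v U - insert v S) *
            (f (insert v S) * g (insert v U - insert v S)))) = P S v + Q S v"
        unfolding P_def Q_def T(1,2) T_def[symmetric] s using T
        by (simp add: ksign_insert_left[where S = S] ksign_insert_right[where T = T] mult_ac)
    qed
    finally show "ksign {v} U * (x v * kmul f g (insert v U)) = (\<Sum>S\<in>Pow U. P S v + Q S v)" .
  qed
  also have "\<dots> = (\<Sum>S\<in>Pow U. \<Sum>v\<in>V - U. P S v) + (\<Sum>S\<in>Pow U. \<Sum>v\<in>V - U. Q S v)"
    by (subst sum.swap) (simp add: sum.distrib)
  finally show ?thesis unfolding 1 2 cancel by simp
qed

text \<open>Up to truncation the new chain is the product dx_v c. With all variables acting as 1,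
  d(dx_v c) = c - dx_v dc, and dc vanishes. Truncating to sets containing X does not affect the
  coefficient at a set U containing X, which involves only supersets of U. \<open>adm\<close> stands
  for the basis sets of a multidegree: c is a cycle only at these, so removing v has to lead to such
  a set again.\<close>

lemma kdiff_contraction:
  fixes c :: "'v::linorder set \<Rightarrow> 'a::comm_ring_1"
  assumes W: "finite W" "v \<in> W" "v \<notin> X"
    and adm: "\<And>S. adm S \<Longrightarrow> S \<subseteq> W"
      "\<And>S. adm S \<Longrightarrow> X \<subseteq> S \<Longrightarrow> v \<in> S \<Longrightarrow> adm (S - {v})"
    and cyc: "\<And>S. adm S \<Longrightarrow> kdiff W (\<lambda>_. 1) c S = 0"
    and U: "adm U" "X \<subseteq> U"
  shows "kdiff W (\<lambda>_. 1) (\<lambda>S. if insert v X \<subseteq> S then ksign {v} (S - {v}) * c (S - {v}) else 0) U = c U"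
    (is "kdiff W _ ?g U = _")
proof (cases "v \<in> U")
  case False
  \<comment> \<open>The new chain is supported on sets containing v, so only w = v
    contributes.\<close>
  have "kdiff W (\<lambda>_. 1) ?g U = (\<Sum>w\<in>{v}. ksign {w} U * (1 * ?g (insert w U)))"
    unfolding kdiff_def using W False by (intro sum.mono_neutral_right) auto
  also have "\<dots> = c U"
    using False U by auto
  finally show ?thesis .
next
  case True
  define T where "T = U - {v}"
  have finT: "finite T" using adm(1)[OF U(1)] W(1) by (auto simp: T_def intro: finite_subset)
  have UT: "U = insert v T" "v \<notin> T" using True by (auto simp: T_def)
  \<comment> \<open>For v in U the identity is extracted from the cycle condition at
    \<open>U - {v}\<close>, whose term at v is \<open>c U\<close> up to sign.\<close>
  have zero: "kdiff W (\<lambda>_. 1) c T = 0"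
    using adm(2)[OF U True] cyc by (simp add: T_def)
  have "W - T = insert v (W - U)" using W UT by auto
  then have "kdiff W (\<lambda>_. 1) c T = ksign {v} T * c U + (\<Sum>w\<in>W - U. ksign {w} T * c (insert w T))"
    unfolding kdiff_def using W True UT(1)[symmetric] by simp
  with zero have rel: "(\<Sum>w\<in>W - U. ksign {w} T * c (insert w T)) = - (ksign {v} T * c U)"
    by (simp add: eq_neg_iff_add_eq_0 add.commute)
  have "kdiff W (\<lambda>_. 1) ?g U = (\<Sum>w\<in>W - U. - (ksign {v} T * (ksign {w} T * c (insert w T))))"
    unfolding kdiff_def
  proof (rule sum.cong[OF refl])
    fix w assume w: "w \<in> W - U"
    then have *: "w \<noteq> v" "w \<notin> T" "insert w U - {v} = insert w T" using UT by auto
    have **: "(ksign {v} {w} :: 'a) = - ksign {w} {v}"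
      by (rule ksign_singletons) (use * in auto)
    have "?g (insert w U) = ksign {v} (insert w T) * c (insert w T)"
      unfolding * using U True by auto
    then show "ksign {w} U * (1 * ?g (insert w U)) = - (ksign {v} T * (ksign {w} T * c (insert w T)))"
      unfolding UT(1) using * UT finT ** by (simp add: ksign_insert_right[where T = T] mult_ac)
  qed
  also have "\<dots> = - (ksign {v} T * (\<Sum>w\<in>W - U. ksign {w} T * c (insert w T)))"
    by (simp add: sum_negf sum_distrib_left)
  also have "\<dots> = c U" by (simp add: rel)
  finally show ?thesis .
qed

section \<open>Polynomial rings and edge ideals\<close>

lemma mpoly_ring_cring: "cring (mpoly_ring V :: ('v, 'k::comm_ring_1) mpoly ring)"
proof (intro cringI abelian_groupI comm_monoidI)
  fix p :: "('v, 'k) mpoly"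
  assume "p \<in> carrier (mpoly_ring V)"
  then show "\<exists>q\<in>carrier (mpoly_ring V). q \<oplus>\<^bsub>mpoly_ring V\<^esub> p = \<zero>\<^bsub>mpoly_ring V\<^esub>"
    by (intro bexI[of _ "- p"]) (auto simp: mpoly_ring_def in_keys_iff)
qed (auto simp: mpoly_ring_def algebra_simps dest!: subsetD[OF Poly_Mapping.keys_add] subsetD[OF keys_mult])

lemma mpoly_ring_simps [simp]:
  "p \<oplus>\<^bsub>mpoly_ring V\<^esub> q = p + q" "p \<otimes>\<^bsub>mpoly_ring V\<^esub> q = p * q"
  "\<zero>\<^bsub>mpoly_ring V\<^esub> = 0" "\<one>\<^bsub>mpoly_ring V\<^esub> = 1"
  by (auto simp: mpoly_ring_def)

lemma in_mpoly_ring_iff: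
  "p \<in> carrier (mpoly_ring V) \<longleftrightarrow> (\<forall>m\<in>Poly_Mapping.keys p. Poly_Mapping.keys m \<subseteq> V)"
  by (simp add: mpoly_ring_def)

lemma mpoly_ring_minus [simp]:
  assumes "p \<in> carrier (mpoly_ring V)"
  shows "\<ominus>\<^bsub>mpoly_ring V\<^esub> p = - p"
proof -
  interpret cring "mpoly_ring V" by (rule mpoly_ring_cring)
  have "- p \<in> carrier (mpoly_ring V)" using assms by (simp add: in_mpoly_ring_iff in_keys_iff)
  from minus_equality[OF _ assms this] show ?thesis by simp
qed

lemma mpoly_ring_closed:
  shows "0 \<in> carrier (mpoly_ring V)"
    and "1 \<in> carrier (mpoly_ring V)"
    and "p \<in> carrier (mpoly_ring V) \<Longrightarrow> - p \<in> carrier (mpoly_ring V)"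
    and "p \<in> carrier (mpoly_ring V) \<Longrightarrow> q \<in> carrier (mpoly_ring V) \<Longrightarrow> p + q \<in> carrier (mpoly_ring V)"
    and "p \<in> carrier (mpoly_ring V) \<Longrightarrow> q \<in> carrier (mpoly_ring V) \<Longrightarrow> p - q \<in> carrier (mpoly_ring V)"
    and "p \<in> carrier (mpoly_ring V) \<Longrightarrow> q \<in> carrier (mpoly_ring V) \<Longrightarrow> p * q \<in> carrier (mpoly_ring V)"
proof -
  interpret cring "mpoly_ring V" by (rule mpoly_ring_cring)
  show uminus: "- p \<in> carrier (mpoly_ring V)" if "p \<in> carrier (mpoly_ring V)" for p
    using that by (simp add: in_mpoly_ring_iff in_keys_iff)
  show add: "p + q \<in> carrier (mpoly_ring V)"
    if "p \<in> carrier (mpoly_ring V)" "q \<in> carrier (mpoly_ring V)" for p q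
    using a_closed[OF that] by simp
  show "p - q \<in> carrier (mpoly_ring V)"
    if "p \<in> carrier (mpoly_ring V)" "q \<in> carrier (mpoly_ring V)"
    using add[OF that(1) uminus[OF that(2)]] by simp
  show "p * q \<in> carrier (mpoly_ring V)"
    if "p \<in> carrier (mpoly_ring V)" "q \<in> carrier (mpoly_ring V)"
    using m_closed[OF that] by simp
qed (use cring.cring_simprules(2,6)[OF mpoly_ring_cring] in simp_all)

lemma mpoly_ring_sum_closed:
  "(\<And>a. a \<in> A \<Longrightarrow> f a \<in> carrier (mpoly_ring V)) \<Longrightarrow> sum f A \<in> carrier (mpoly_ring V)"
  by (induction A rule: infinite_finite_induct) (auto intro: mpoly_ring_closed)

lemma ksign_mpoly_closed: "(ksign S T :: ('v::linorder, 'k::comm_ring_1) mpoly) \<in> carrier (mpoly_ring V)"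
  unfolding ksign_def by (cases "even (inversions S T)") (auto intro: mpoly_ring_closed)

lemma mpoly_var_closed [simp]: "v \<in> V \<Longrightarrow> mpoly_var v \<in> carrier (mpoly_ring V)"
  by (auto simp: mpoly_var_def in_mpoly_ring_iff)

lemma single_in_mpoly_ring: "Poly_Mapping.keys m \<subseteq> V \<Longrightarrow> Poly_Mapping.single m a \<in> carrier (mpoly_ring V)"
  by (auto simp: in_mpoly_ring_iff)

lemma mpoly_const_closed [simp]: "mpoly_const c \<in> carrier (mpoly_ring V)"
  by (simp add: mpoly_const_def single_in_mpoly_ring)

lemma sum_single_lookup:
  "(\<Sum>m\<in>Poly_Mapping.keys p. Poly_Mapping.single m (Poly_Mapping.lookup p m)) = p"
  by (rule poly_mapping_eqI) (simp add: lookup_sum lookup_single when_def in_keys_iff)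

lemma keys_add_nat:
  fixes m n :: "'a \<Rightarrow>\<^sub>0 nat"
  shows "Poly_Mapping.keys (m + n) = Poly_Mapping.keys m \<union> Poly_Mapping.keys n"
  by (auto simp: in_keys_iff lookup_add)

section \<open>Membership in the edge ideal\<close>

lemma edge_ideal_subset_carrier:
  assumes "pair_graph G"
  shows "{mpoly_var u * mpoly_var v | u v. (u, v) \<in> parcs G} \<subseteq> carrier (mpoly_ring (pverts G))"
proof -
  interpret pair_graph G by fact
  show ?thesis by (auto intro!: mpoly_ring_closed dest: in_arcsD1 in_arcsD2)
qed

lemma edge_ideal_ideal:
  assumes "pair_graph G"
  shows "ideal (edge_ideal G) (mpoly_ring (pverts G))"
  unfolding edge_ideal_def
  by (intro ring.genideal_ideal cring.axioms mpoly_ring_cring edge_ideal_subset_carrier assms)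

text \<open>The ideal is monomial. Supports grow under multiplication, so the polynomials on the
  right form an ideal, and it contains the generators. Conversely, a monomial with dependent support
  is divisible by the product of two adjacent variables.\<close>

lemma edge_ideal_iff:
  fixes p :: "('v, 'k::comm_ring_1) mpoly"
  assumes G: "pair_graph G"
  shows "p \<in> edge_ideal G \<longleftrightarrow> (\<forall>m\<in>Poly_Mapping.keys p.
    Poly_Mapping.keys m \<subseteq> pverts G \<and> \<not> independent_verts G (Poly_Mapping.keys m))"
proof
  interpret pair_graph G by fact
  interpret Q: cring "mpoly_ring (pverts G) :: ('v, 'k) mpoly ring" by (rule mpoly_ring_cring)
  let ?J = "{p :: ('v, 'k) mpoly. \<forall>m\<in>Poly_Mapping.keys p.
    Poly_Mapping.keys m \<subseteq> pverts G \<and> \<not> independent_verts G (Poly_Mapping.keys m)}"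
  have mult: "p * q \<in> ?J" if "p \<in> ?J" "q \<in> carrier (mpoly_ring (pverts G))" for p q
  proof -
    have "Poly_Mapping.keys (a + b) \<subseteq> pverts G \<and> \<not> independent_verts G (Poly_Mapping.keys (a + b))"
      if "a \<in> Poly_Mapping.keys p" "b \<in> Poly_Mapping.keys q" for a b
      using that \<open>p \<in> ?J\<close> \<open>q \<in> _\<close> independent_verts_subset[of G "Poly_Mapping.keys (a + b)" "Poly_Mapping.keys a"]
      by (auto simp: keys_add_nat in_mpoly_ring_iff)
    then show ?thesis using keys_mult[of p q] by fastforce
  qed
  have J: "ideal ?J (mpoly_ring (pverts G))"
  proof (rule idealI)
    show "subgroup ?J (add_monoid (mpoly_ring (pverts G)))"
    proof (rule group.subgroupI[OF Q.a_group])
      fix a assume "a \<in> ?J"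
      then show "inv\<^bsub>add_monoid (mpoly_ring (pverts G))\<^esub> a \<in> ?J"
        unfolding a_inv_def[symmetric] by (subst mpoly_ring_minus) (auto simp: in_mpoly_ring_iff in_keys_iff)
    qed (auto simp: in_mpoly_ring_iff dest!: subsetD[OF Poly_Mapping.keys_add] intro!: exI[of _ 0])
    show "x \<otimes>\<^bsub>mpoly_ring (pverts G)\<^esub> a \<in> ?J" if "a \<in> ?J" "x \<in> carrier (mpoly_ring (pverts G))" for a x
      using mult[OF that] by (simp add: mult.commute)
    show "a \<otimes>\<^bsub>mpoly_ring (pverts G)\<^esub> x \<in> ?J" if "a \<in> ?J" "x \<in> carrier (mpoly_ring (pverts G))" for a x
      using mult[OF that] by simp
  qed (rule Q.ring_axioms)
  have "(mpoly_var u * mpoly_var v :: ('v, 'k) mpoly) \<in> ?J" if "(u, v) \<in> parcs G" for u v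
    using that in_arcsD1 in_arcsD2
    by (auto simp: mpoly_var_def mult_single keys_add_nat independent_verts_def)
  then have "edge_ideal G \<subseteq> ?J"
    unfolding edge_ideal_def by (intro Q.genideal_minimal J) auto
  then show "p \<in> edge_ideal G \<Longrightarrow> \<forall>m\<in>Poly_Mapping.keys p.
    Poly_Mapping.keys m \<subseteq> pverts G \<and> \<not> independent_verts G (Poly_Mapping.keys m)" by auto
  interpret I: ideal "edge_ideal G" "mpoly_ring (pverts G) :: ('v, 'k) mpoly ring"
    by (rule edge_ideal_ideal[OF G])
  assume p: "\<forall>m\<in>Poly_Mapping.keys p.
    Poly_Mapping.keys m \<subseteq> pverts G \<and> \<not> independent_verts G (Poly_Mapping.keys m)"
  have single: "Poly_Mapping.single m a \<in> edge_ideal G" if m: "m \<in> Poly_Mapping.keys p" for m and a :: 'k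
  proof -
    from p m obtain u v where uv: "u \<in> Poly_Mapping.keys m" "v \<in> Poly_Mapping.keys m" "(u, v) \<in> parcs G"
      and mV: "Poly_Mapping.keys m \<subseteq> pverts G"
      by (auto simp: independent_verts_def)
    have "u \<noteq> v" using uv(3) pair_no_loops by fastforce
    \<comment> \<open>The quotient of m by the two adjacent variables. As u and v are distinct and
      in the support, the truncated subtractions lose nothing.\<close>
    define n where "n = m - Poly_Mapping.single u 1 - Poly_Mapping.single v 1"
    have m: "m = n + (Poly_Mapping.single u 1 + Poly_Mapping.single v 1)"
      using uv \<open>u \<noteq> v\<close>
      by (intro poly_mapping_eqI) (auto simp: n_def lookup_add lookup_minus lookup_single in_keys_iff when_def)
    have "Poly_Mapping.single m a = Poly_Mapping.single n a * (mpoly_var u * mpoly_var v)"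
      unfolding m mpoly_var_def by (simp add: mult_single)
    moreover have "(mpoly_var u * mpoly_var v :: ('v, 'k) mpoly) \<in> edge_ideal G"
      using Q.genideal_self[OF edge_ideal_subset_carrier[OF G]] uv(3) unfolding edge_ideal_def by auto
    moreover have "Poly_Mapping.single n a \<in> carrier (mpoly_ring (pverts G))"
      using mV unfolding m by (intro single_in_mpoly_ring) (simp add: keys_add_nat)
    ultimately show ?thesis
      using I.I_l_closed[of "mpoly_var u * mpoly_var v" "Poly_Mapping.single n a"] by simp
  qed
  have "(\<Sum>m\<in>A. Poly_Mapping.single m (Poly_Mapping.lookup p m)) \<in> edge_ideal G"
    if "A \<subseteq> Poly_Mapping.keys p" for A
    using that
  proof (induction A rule: infinite_finite_induct)
    case (insert m A)
    then show ?case using I.a_closed[OF single] by simp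
  qed (use I.zero_closed in simp_all)
  from this[of "Poly_Mapping.keys p"] show "p \<in> edge_ideal G"
    by (simp add: sum_single_lookup)
qed

lemma edge_ideal_closed:
  assumes G: "pair_graph G"
  shows "0 \<in> edge_ideal G"
    and "p \<in> edge_ideal G \<Longrightarrow> - p \<in> edge_ideal G"
    and "p \<in> edge_ideal G \<Longrightarrow> q \<in> edge_ideal G \<Longrightarrow> p + q \<in> edge_ideal G"
    and "p \<in> edge_ideal G \<Longrightarrow> q \<in> edge_ideal G \<Longrightarrow> p - q \<in> edge_ideal G"
    and "p \<in> edge_ideal G \<Longrightarrow> q \<in> carrier (mpoly_ring (pverts G)) \<Longrightarrow> p * q \<in> edge_ideal G"
    and "p \<in> edge_ideal G \<Longrightarrow> q \<in> carrier (mpoly_ring (pverts G)) \<Longrightarrow> q * p \<in> edge_ideal G"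
proof -
  interpret I: ideal "edge_ideal G" "mpoly_ring (pverts G)"
    by (rule edge_ideal_ideal[OF G])
  show neg: "- p \<in> edge_ideal G" if "p \<in> edge_ideal G" for p
    using that by (simp add: edge_ideal_iff[OF G] in_keys_iff)
  show add: "p + q \<in> edge_ideal G" if "p \<in> edge_ideal G" "q \<in> edge_ideal G" for p q
    using that Poly_Mapping.keys_add[of p q] by (auto simp: edge_ideal_iff[OF G])
  show "p - q \<in> edge_ideal G" if "p \<in> edge_ideal G" "q \<in> edge_ideal G"
    using add[OF that(1) neg[OF that(2)]] by simp
  show "p * q \<in> edge_ideal G" if "p \<in> edge_ideal G" "q \<in> carrier (mpoly_ring (pverts G))"
    using I.I_r_closed[OF that] by simp
  show "q * p \<in> edge_ideal G" if "p \<in> edge_ideal G" "q \<in> carrier (mpoly_ring (pverts G))"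
    using I.I_l_closed[OF that] by simp
  show "0 \<in> edge_ideal G" by (simp add: edge_ideal_iff[OF G])
qed

lemma edge_ideal_sum_closed:
  "pair_graph G \<Longrightarrow> (\<And>a. a \<in> A \<Longrightarrow> f a \<in> edge_ideal G) \<Longrightarrow> sum f A \<in> edge_ideal G"
  by (induction A rule: infinite_finite_induct) (auto intro: edge_ideal_closed)

text \<open>Lifts of Koszul chains over the edge ring to polynomials. Values at sets outside
  \<open>Pow V\<close> do not enter the chain and are left free.\<close>

definition poly_chains :: "'v set \<Rightarrow> ('v set \<Rightarrow> ('v, 'k::comm_ring_1) mpoly) set" where
  "poly_chains V = {f. \<forall>S\<subseteq>V. f S \<in> carrier (mpoly_ring V)}"

lemma kdiff_poly_chains:
  assumes "f \<in> poly_chains V"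
  shows "kdiff V mpoly_var f \<in> poly_chains V"
  using assms unfolding poly_chains_def kdiff_def
  by (auto intro!: mpoly_ring_sum_closed mpoly_ring_closed ksign_mpoly_closed)

lemma kmul_poly_chains:
  assumes "f \<in> poly_chains V" "g \<in> poly_chains V"
  shows "kmul f g \<in> poly_chains V"
  using assms unfolding poly_chains_def kmul_def mem_Collect_eq
  by (intro allI impI mpoly_ring_sum_closed mpoly_ring_closed ksign_mpoly_closed)
    (metis PowD subset_trans Diff_subset)+

text \<open>Representatives of the \<open>k\<close>-algebra expressions in the star cycles \<open>x\<^sub>u dx\<^sub>L\<close>.\<close>

inductive_set koszul_gen ::
  "'v::linorder pair_pre_digraph \<Rightarrow> ('v set \<Rightarrow> ('v, 'k::comm_ring_1) mpoly) set"
  for G where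
  scalar: "(\<lambda>S. if S = {} then mpoly_const c else 0) \<in> koszul_gen G"
| star: "u \<in> pverts G \<Longrightarrow> L \<noteq> {} \<Longrightarrow> L \<subseteq> {w. (u, w) \<in> parcs G} \<Longrightarrow>
    (\<lambda>S. if S = L then mpoly_var u else 0) \<in> koszul_gen G"
| add: "f \<in> koszul_gen G \<Longrightarrow> g \<in> koszul_gen G \<Longrightarrow> (\<lambda>S. f S + g S) \<in> koszul_gen G"
| mult: "f \<in> koszul_gen G \<Longrightarrow> g \<in> koszul_gen G \<Longrightarrow> kmul f g \<in> koszul_gen G"
| homologous: "f \<in> koszul_gen G \<Longrightarrow> h \<in> poly_chains (pverts G) \<Longrightarrow> f' \<in> poly_chains (pverts G) \<Longrightarrow>
    (\<And>S. S \<subseteq> pverts G \<Longrightarrow> f' S - f S - kdiff (pverts G) mpoly_var h S \<in> edge_ideal G) \<Longrightarrow>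
    f' \<in> koszul_gen G"

lemma koszul_gen_zero: "(\<lambda>S. 0 :: ('v::linorder, 'k::comm_ring_1) mpoly) \<in> koszul_gen G"
  using koszul_gen.scalar[of "0::'k" G] by (simp add: mpoly_const_def cong: if_cong)

lemma koszul_gen_sum:
  "finite A \<Longrightarrow> (\<And>a. a \<in> A \<Longrightarrow> F a \<in> koszul_gen G) \<Longrightarrow> (\<lambda>S. \<Sum>a\<in>A. F a S) \<in> koszul_gen G"
proof (induction A rule: finite_induct)
  case (insert a A)
  then show ?case using koszul_gen.add[of "F a" G "\<lambda>S. \<Sum>a\<in>A. F a S"] by simp
qed (simp add: koszul_gen_zero)

section \<open>Multihomogeneous cycles\<close>

lemma independent_verts_insert:
  "independent_verts G T \<Longrightarrow> (v, v) \<notin> parcs G \<Longrightarrow>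
    (\<And>a. a \<in> T \<Longrightarrow> (v, a) \<notin> parcs G \<and> (a, v) \<notin> parcs G) \<Longrightarrow>
    S \<subseteq> insert v T \<Longrightarrow> independent_verts G S"
  unfolding independent_verts_def by blast

text \<open>Exponent vector of the product of the variables in S. Subtraction of exponents is
  truncated at 0, so \<open>\<alpha> - var_prod S\<close> belongs to a true quotient only if S lies
  in the support of \<alpha>.\<close>

definition var_prod :: "'v set \<Rightarrow> 'v \<Rightarrow>\<^sub>0 nat" where
  "var_prod S = (\<Sum>v\<in>S. Poly_Mapping.single v 1)"

lemma lookup_var_prod:
  "finite S \<Longrightarrow> Poly_Mapping.lookup (var_prod S) v = (if v \<in> S then 1 else 0)"
  by (simp add: var_prod_def lookup_sum lookup_single when_def)

lemma keys_var_prod [simp]: "finite S \<Longrightarrow> Poly_Mapping.keys (var_prod S) = S"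
  by (auto simp: in_keys_iff lookup_var_prod split: if_splits)

lemma keys_diff_var_prod:
  "finite S \<Longrightarrow> Poly_Mapping.keys (\<alpha> - var_prod S) =
    {w \<in> Poly_Mapping.keys \<alpha>. w \<notin> S \<or> 2 \<le> Poly_Mapping.lookup \<alpha> w}"
  by (auto simp: in_keys_iff lookup_minus lookup_var_prod split: if_splits)

lemma var_prod_diff:
  "finite W \<Longrightarrow> S \<subseteq> W \<Longrightarrow> var_prod W - var_prod S = var_prod (W - S)"
  by (rule poly_mapping_eqI) (auto simp: lookup_minus lookup_var_prod finite_subset)

text \<open>
  The part of multidegree \<open>\<alpha>\<close> of the Koszul complex of the edge ring has the basis
  \<open>x\<^bsup>\<alpha> - S\<^esup> dx\<^sub>S\<close>, where \<open>S\<close> ranges over the sets below.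
\<close>

definition basis_set :: "'v pair_pre_digraph \<Rightarrow> ('v \<Rightarrow>\<^sub>0 nat) \<Rightarrow> 'v set \<Rightarrow> bool" where
  "basis_set G \<alpha> S \<longleftrightarrow> S \<subseteq> Poly_Mapping.keys \<alpha> \<and>
     independent_verts G (Poly_Mapping.keys (\<alpha> - var_prod S))"

text \<open>The chain with scalar coefficients c in the monomial basis of multidegree \<alpha>;
  values of c at other sets are discarded.\<close>

definition homogeneous_chain ::
  "'v pair_pre_digraph \<Rightarrow> ('v \<Rightarrow>\<^sub>0 nat) \<Rightarrow> ('v set \<Rightarrow> 'k) \<Rightarrow> 'v set \<Rightarrow> ('v, 'k::comm_ring_1) mpoly" where
  "homogeneous_chain G \<alpha> c S =
     (if basis_set G \<alpha> S then Poly_Mapping.single (\<alpha> - var_prod S) (c S) else 0)"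

lemma homogeneous_chain_zero: "homogeneous_chain G \<alpha> (\<lambda>_. 0) = (\<lambda>_. 0)"
  by (simp add: homogeneous_chain_def fun_eq_iff)

lemma basis_set_finite: "basis_set G \<alpha> S \<Longrightarrow> finite S"
  by (auto simp: basis_set_def intro: finite_subset)

text \<open>Enlarging U can only shrink the support of the remaining monomial.\<close>

lemma basis_set_insert:
  assumes "basis_set G \<alpha> U" "v \<in> Poly_Mapping.keys \<alpha>"
  shows "basis_set G \<alpha> (insert v U)"
  using assms basis_set_finite[OF assms(1)] unfolding basis_set_def
  by (auto simp: keys_diff_var_prod intro: independent_verts_subset)

lemma homogeneous_chain_poly_chains:
  "Poly_Mapping.keys \<alpha> \<subseteq> V \<Longrightarrow> homogeneous_chain G \<alpha> c \<in> poly_chains V"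
  unfolding poly_chains_def homogeneous_chain_def
  by (auto intro!: single_in_mpoly_ring mpoly_ring_closed
      dest!: basis_set_finite simp: keys_diff_var_prod)

text \<open>The sign on the left is a polynomial, the one on the right a scalar; this links the
  polynomial complex to the scalar one.\<close>

lemma ksign_times_single:
  "ksign S T * Poly_Mapping.single m a = Poly_Mapping.single m (ksign S T * a :: 'k::comm_ring_1)"
  unfolding ksign_def by (cases "even (inversions S T)") (auto simp: single_uminus)

lemma lookup_ksign_times:
  "Poly_Mapping.lookup (ksign S T * p) m = (ksign S T * Poly_Mapping.lookup p m :: 'k::comm_ring_1)"
  for p :: "('v::linorder, 'k::comm_ring_1) mpoly"
  unfolding ksign_def by (cases "even (inversions S T)") auto

lemma mpoly_var_times_single:
  assumes "finite S" "S \<subseteq> Poly_Mapping.keys \<alpha>" "v \<in> Poly_Mapping.keys \<alpha>" "v \<notin> S"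
  shows "mpoly_var v * Poly_Mapping.single (\<alpha> - var_prod (insert v S)) a =
    Poly_Mapping.single (\<alpha> - var_prod S) (a :: 'k::comm_ring_1)"
proof -
  have "Poly_Mapping.single v 1 + (\<alpha> - var_prod (insert v S)) = \<alpha> - var_prod S"
    using assms
    by (intro poly_mapping_eqI)
      (auto simp: lookup_add lookup_minus lookup_single lookup_var_prod in_keys_iff when_def)
  then show ?thesis by (simp add: mpoly_var_def mult_single)
qed

lemma lookup_mpoly_var_times:
  fixes p :: "('v, 'k::comm_ring_1) mpoly"
  shows "Poly_Mapping.lookup (mpoly_var v * p) m =
    (if v \<in> Poly_Mapping.keys m then Poly_Mapping.lookup p (m - Poly_Mapping.single v 1) else 0)"
proof -
  have eq: "m = Poly_Mapping.single v 1 + q \<longleftrightarrow> v \<in> Poly_Mapping.keys m \<and> q = m - Poly_Mapping.single v 1" for q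
  proof
    assume "m = Poly_Mapping.single v 1 + q"
    then show "v \<in> Poly_Mapping.keys m \<and> q = m - Poly_Mapping.single v 1"
      by (simp add: keys_add_nat)
  next
    assume *: "v \<in> Poly_Mapping.keys m \<and> q = m - Poly_Mapping.single v 1"
    show "m = Poly_Mapping.single v 1 + q"
      using * by (intro poly_mapping_eqI) (auto simp: lookup_add lookup_minus lookup_single in_keys_iff when_def)
  qed
  have "Poly_Mapping.lookup (mpoly_var v * p) m =
      (\<Sum>q. Poly_Mapping.lookup p q when m = Poly_Mapping.single v 1 + q)"
    by (simp add: lookup_mult mpoly_var_def lookup_single when_mult)
  also have "\<dots> = (\<Sum>q. (Poly_Mapping.lookup p q when q = m - Poly_Mapping.single v 1) when v \<in> Poly_Mapping.keys m)"
    unfolding eq by (simp add: when_when conj_commute)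
  also have "\<dots> = (if v \<in> Poly_Mapping.keys m then Poly_Mapping.lookup p (m - Poly_Mapping.single v 1) else 0)"
    by simp
  finally show ?thesis .
qed

text \<open>Multiplying by x_v turns the monomial belonging to \<open>insert v U\<close> into the
  one belonging to U, so every variable acts as 1 on the monomial basis.\<close>

lemma kdiff_homogeneous_chain:
  fixes c :: "'v::linorder set \<Rightarrow> 'k::comm_ring_1"
  assumes V: "finite V" "Poly_Mapping.keys \<alpha> \<subseteq> V" and U: "basis_set G \<alpha> U"
  shows "kdiff V mpoly_var (homogeneous_chain G \<alpha> c) U =
    Poly_Mapping.single (\<alpha> - var_prod U) (kdiff (Poly_Mapping.keys \<alpha>) (\<lambda>_. 1) c U)"
proof -
  \<comment> \<open>For v outside the support of \<alpha>, \<open>insert v U\<close> is not a basis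
    set and its term vanishes.\<close>
  have "kdiff V mpoly_var (homogeneous_chain G \<alpha> c) U =
      (\<Sum>v\<in>Poly_Mapping.keys \<alpha> - U. ksign {v} U * (mpoly_var v * homogeneous_chain G \<alpha> c (insert v U)))"
    unfolding kdiff_def using V
    by (intro sum.mono_neutral_right) (auto simp: homogeneous_chain_def basis_set_def)
  also have "\<dots> = (\<Sum>v\<in>Poly_Mapping.keys \<alpha> - U.
      Poly_Mapping.single (\<alpha> - var_prod U) (ksign {v} U * (1 * c (insert v U))))"
  proof (rule sum.cong[OF refl])
    fix v assume v: "v \<in> Poly_Mapping.keys \<alpha> - U"
    then have "mpoly_var v * homogeneous_chain G \<alpha> c (insert v U) =
        Poly_Mapping.single (\<alpha> - var_prod U) (c (insert v U))"
      using U basis_set_insert[OF U] basis_set_finite[OF U]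
      by (simp add: homogeneous_chain_def mpoly_var_times_single basis_set_def)
    then show "ksign {v} U * (mpoly_var v * homogeneous_chain G \<alpha> c (insert v U)) =
        Poly_Mapping.single (\<alpha> - var_prod U) (ksign {v} U * (1 * c (insert v U)))"
      by (simp add: ksign_times_single)
  qed
  also have "\<dots> = Poly_Mapping.single (\<alpha> - var_prod U) (kdiff (Poly_Mapping.keys \<alpha>) (\<lambda>_. 1) c U)"
    unfolding kdiff_def
    by (rule poly_mapping_eqI) (simp add: lookup_sum lookup_single when_def)
  finally show ?thesis .
qed

text \<open>A nonzero term requires \<open>insert v U\<close> to be a basis set. Then U lies in the
  support of \<alpha>, so it fails to be a basis set only because the monomial left at U has
  dependent support, and the term lies in the ideal.\<close>

lemma kdiff_homogeneous_chain_in_ideal: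
  fixes c :: "'v::linorder set \<Rightarrow> 'k::comm_ring_1"
  assumes G: "pair_graph G" and \<alpha>: "Poly_Mapping.keys \<alpha> \<subseteq> pverts G" and U: "\<not> basis_set G \<alpha> U"
  shows "kdiff (pverts G) mpoly_var (homogeneous_chain G \<alpha> c) U \<in> edge_ideal G"
  unfolding kdiff_def
proof (rule edge_ideal_sum_closed[OF G])
  fix v assume v: "v \<in> pverts G - U"
  have "mpoly_var v * homogeneous_chain G \<alpha> c (insert v U) \<in> edge_ideal G"
  proof (cases "basis_set G \<alpha> (insert v U)")
    case True
    then have *: "finite U" "U \<subseteq> Poly_Mapping.keys \<alpha>" "v \<in> Poly_Mapping.keys \<alpha>"
      using basis_set_finite[OF True] by (auto simp: basis_set_def)
    then have "mpoly_var v * homogeneous_chain G \<alpha> c (insert v U) =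
        Poly_Mapping.single (\<alpha> - var_prod U) (c (insert v U))"
      using True v by (simp add: homogeneous_chain_def mpoly_var_times_single)
    moreover have "Poly_Mapping.keys (\<alpha> - var_prod U) \<subseteq> pverts G"
      using \<alpha> * by (auto simp: keys_diff_var_prod)
    ultimately show ?thesis
      using U * by (simp add: edge_ideal_iff[OF G] basis_set_def)
  next
    case False
    then show ?thesis by (simp add: homogeneous_chain_def edge_ideal_closed[OF G])
  qed
  then show "ksign {v} U * (mpoly_var v * homogeneous_chain G \<alpha> c (insert v U)) \<in> edge_ideal G"
    by (rule edge_ideal_closed(6)[OF G _ ksign_mpoly_closed])
qed

text \<open>Lifts a relation c = c' + dg between scalar coefficients to polynomial chains. Outside
  the basis sets the differential of the lift of g lies in the edge ideal.\<close>

lemma koszul_gen_homogeneous: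
  fixes c c' g :: "'v::linorder set \<Rightarrow> 'k::comm_ring_1"
  assumes G: "pair_graph G" and \<alpha>: "Poly_Mapping.keys \<alpha> \<subseteq> pverts G"
    and gen: "homogeneous_chain G \<alpha> c' \<in> koszul_gen G"
    and eq: "\<And>U. basis_set G \<alpha> U \<Longrightarrow> c U = c' U + kdiff (Poly_Mapping.keys \<alpha>) (\<lambda>_. 1) g U"
  shows "homogeneous_chain G \<alpha> c \<in> koszul_gen G"
proof (rule koszul_gen.homologous[OF gen])
  interpret pair_graph G by fact
  fix U assume "U \<subseteq> pverts G"
  show "homogeneous_chain G \<alpha> c U - homogeneous_chain G \<alpha> c' U -
      kdiff (pverts G) mpoly_var (homogeneous_chain G \<alpha> g) U \<in> edge_ideal G"
  proof (cases "basis_set G \<alpha> U")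
    case True
    then show ?thesis
      using kdiff_homogeneous_chain[OF pair_finite_verts \<alpha> True, of g] eq[OF True]
      by (simp add: homogeneous_chain_def edge_ideal_closed[OF G] flip: single_diff)
  next
    case False
    then show ?thesis
      using kdiff_homogeneous_chain_in_ideal[OF G \<alpha> False, of g] edge_ideal_closed(2)[OF G]
      by (simp add: homogeneous_chain_def)
  qed
qed (intro homogeneous_chain_poly_chains \<alpha>)+

lemma kmul_star:
  fixes a :: "'a::comm_ring_1"
  assumes "finite U"
  shows "kmul (\<lambda>S. if S = L then a else 0) g U =
    (if L \<subseteq> U then ksign L (U - L) * (a * g (U - L)) else 0)"
proof -
  have "kmul (\<lambda>S. if S = L then a else 0) g U =
      (\<Sum>S\<in>Pow U. if S = L then ksign L (U - L) * (a * g (U - L)) else 0)"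
    unfolding kmul_def by (intro sum.cong) auto
  then show ?thesis using assms by simp
qed

text \<open>Induction on the number of variables in the multidegree. The induction hypothesis enters
  in the leaf case, for the multidegree left after removing u and its neighbours.\<close>

lemma homogeneous_cycle_in_koszul_gen:
  fixes c :: "'v::linorder set \<Rightarrow> 'k::comm_ring_1"
  assumes G: "pair_graph G"
    and leaf: "\<And>W. W \<subseteq> pverts G \<Longrightarrow> W \<noteq> {} \<Longrightarrow>
      \<exists>v\<in>W. \<forall>a\<in>W. \<forall>b\<in>W. (v, a) \<in> parcs G \<longrightarrow> (v, b) \<in> parcs G \<longrightarrow> a = b"
    and "Poly_Mapping.keys \<alpha> \<subseteq> pverts G"
    and "\<And>U. basis_set G \<alpha> U \<Longrightarrow> kdiff (Poly_Mapping.keys \<alpha>) (\<lambda>_. 1) c U = 0"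
  shows "homogeneous_chain G \<alpha> c \<in> koszul_gen G"
  using assms(3,4)
proof (induction "card (Poly_Mapping.keys \<alpha>)" arbitrary: \<alpha> c rule: less_induct)
  case less
  interpret pair_graph G by fact
  note \<alpha> = less.prems(1) and cyc = less.prems(2)
  let ?W = "Poly_Mapping.keys \<alpha>"
  have sym: "(a, b) \<in> parcs G \<Longrightarrow> (b, a) \<in> parcs G" for a b
    using graph_symmetric by blast
  have noloop: "(a, a) \<notin> parcs G" for a
    using pair_no_loops by fastforce
  \<comment> \<open>Left multiplication by dx_v, kept only on sets containing X. X = {} contracts a
    whole multidegree; the leaf case takes X = {u}.\<close>
  define contr where "contr v X = (\<lambda>S. if insert v X \<subseteq> S then ksign {v} (S - {v}) * c (S - {v}) else 0)" for v X
  have contraction: "kdiff ?W (\<lambda>_. 1) (contr v X) U = c U"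
    if "v \<in> ?W" "v \<notin> X" "basis_set G \<alpha> U" "X \<subseteq> U"
      "\<And>S. basis_set G \<alpha> S \<Longrightarrow> X \<subseteq> S \<Longrightarrow> v \<in> S \<Longrightarrow> basis_set G \<alpha> (S - {v})" for v X U
    unfolding contr_def
    by (rule kdiff_contraction[where adm = "basis_set G \<alpha>"]) (use that cyc in \<open>auto simp: basis_set_def\<close>)
  \<comment> \<open>The vertex supplied by the assumption has at most one neighbour in the support:
    none gives \<open>isolated\<close>, one gives \<open>leaf\<close>. In \<open>leaf\<close> the
    multidegree is squarefree, as otherwise \<open>square\<close> applies.\<close>
  consider (zero) "?W = {}"
    | (square) v where "v \<in> ?W" "2 \<le> Poly_Mapping.lookup \<alpha> v"
    | (isolated) v where "v \<in> ?W" "\<And>a. a \<in> ?W \<Longrightarrow> (v, a) \<notin> parcs G"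
    | (leaf) v u where "\<And>w. w \<in> ?W \<Longrightarrow> Poly_Mapping.lookup \<alpha> w < 2" "v \<in> ?W" "u \<in> ?W"
        "(v, u) \<in> parcs G" "\<And>a. a \<in> ?W \<Longrightarrow> (v, a) \<in> parcs G \<Longrightarrow> a = u"
    using assms(2)[OF \<alpha>] by (metis linorder_not_less)
  then show ?case
  proof cases
    case zero
    then have [simp]: "\<alpha> = 0" by simp
    have "homogeneous_chain G \<alpha> c = (\<lambda>S. if S = {} then mpoly_const (c {}) else 0)"
      by (auto simp: homogeneous_chain_def basis_set_def independent_verts_def mpoly_const_def var_prod_def fun_eq_iff)
    then show ?thesis by (simp add: koszul_gen.scalar)
  next
    case square
    have "basis_set G \<alpha> (S - {v})" if "basis_set G \<alpha> S" for S
    proof -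
      \<comment> \<open>With exponent at least 2, x_v divides the remaining monomial whether or not
        v is in S.\<close>
      have "Poly_Mapping.keys (\<alpha> - var_prod (S - {v})) = Poly_Mapping.keys (\<alpha> - var_prod S)"
        using basis_set_finite[OF that] square by (auto simp: keys_diff_var_prod)
      then show ?thesis using that by (auto simp: basis_set_def)
    qed
    then have "c U = 0 + kdiff ?W (\<lambda>_. 1) (contr v {}) U" if "basis_set G \<alpha> U" for U
      using contraction[of v "{}" U] square that by simp
    then show ?thesis
      by (rule koszul_gen_homogeneous[OF G \<alpha>, where c' = "\<lambda>_. 0", rotated])
        (simp_all add: homogeneous_chain_zero koszul_gen_zero)
  next
    case isolated
    \<comment> \<open>Removing v from S puts x_v back into the monomial, which creates no edge
      because v is isolated in the support.\<close>
    have "basis_set G \<alpha> (S - {v})" if "basis_set G \<alpha> S" for S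
    proof -
      have "Poly_Mapping.keys (\<alpha> - var_prod (S - {v})) \<subseteq> insert v (Poly_Mapping.keys (\<alpha> - var_prod S))"
        "Poly_Mapping.keys (\<alpha> - var_prod S) \<subseteq> ?W"
        using basis_set_finite[OF that] by (auto simp: keys_diff_var_prod)
      moreover have "(a, v) \<notin> parcs G" if "a \<in> ?W" for a
        using isolated(2)[OF that] sym by blast
      moreover have "independent_verts G (insert v T)"
        if "T \<subseteq> ?W" "independent_verts G T" for T
        using that isolated(2) sym noloop unfolding independent_verts_def by blast
      ultimately show ?thesis using that
        unfolding basis_set_def by (meson Diff_subset independent_verts_subset subset_trans)
    qed
    then have "c U = 0 + kdiff ?W (\<lambda>_. 1) (contr v {}) U" if "basis_set G \<alpha> U" for U
      using contraction[of v "{}" U] isolated that by simp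
    then show ?thesis
      by (rule koszul_gen_homogeneous[OF G \<alpha>, where c' = "\<lambda>_. 0", rotated])
        (simp_all add: homogeneous_chain_zero koszul_gen_zero)
  next
    case leaf
    have finW: "finite ?W" by simp
    have \<alpha>_eq: "\<alpha> = var_prod ?W"
    proof (rule poly_mapping_eqI)
      fix w
      show "Poly_Mapping.lookup \<alpha> w = Poly_Mapping.lookup (var_prod ?W) w"
        using leaf(1)[of w] by (cases "w \<in> ?W") (simp_all add: lookup_var_prod in_keys_iff)
    qed
    have basis: "basis_set G \<alpha> S \<longleftrightarrow> S \<subseteq> ?W \<and> independent_verts G (?W - S)" for S
      unfolding basis_set_def using finite_subset[OF _ finW]
      by (subst (2) \<alpha>_eq) (auto simp: var_prod_diff)
    have "u \<noteq> v" using leaf noloop by blast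
    \<comment> \<open>The only neighbour u of v in the support lies in S and so is absent from the
      monomial; x_v can be put back.\<close>
    have vstep: "basis_set G \<alpha> (S - {v})" if S: "basis_set G \<alpha> S" "{u} \<subseteq> S" for S
    proof -
      have "?W - (S - {v}) \<subseteq> insert v (?W - S)" by auto
      moreover have "(v, a) \<notin> parcs G \<and> (a, v) \<notin> parcs G" if "a \<in> ?W - S" for a
        using leaf(5)[of a] sym[of a v] that S by blast
      moreover have "S - {v} \<subseteq> ?W" "independent_verts G (?W - S)" using S by (auto simp: basis)
      ultimately show ?thesis using noloop[of v] unfolding basis
        by (blast intro: independent_verts_insert)
    qed
    \<comment> \<open>Subtracting this boundary gives a homologous cycle that vanishes at all basis
      sets containing u.\<close>
    define c' where "c' = (\<lambda>S. c S - kdiff ?W (\<lambda>_. 1) (contr v {u}) S)"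
    have c'_u: "c' U = 0" if "basis_set G \<alpha> U" "u \<in> U" for U
      using contraction[of v "{u}" U] that vstep leaf(2) \<open>u \<noteq> v\<close> by (simp add: c'_def)
    have c'_cyc: "kdiff ?W (\<lambda>_. 1) c' U = 0" if "basis_set G \<alpha> U" for U
      unfolding c'_def kdiff_diff using cyc[OF that] basis_set_finite[OF that]
      by (simp add: kdiff_kdiff)
    \<comment> \<open>At the other basis sets x_u divides the monomial, so independence forces every
      neighbour of u in the support into the index set.\<close>
    define N where "N = {w \<in> ?W. (u, w) \<in> parcs G}"
    define W' where "W' = ?W - N - {u}"
    have N: "N \<subseteq> ?W" "finite N" "v \<in> N" "u \<notin> N" and W': "W' \<subseteq> ?W" "finite W'" "N \<inter> W' = {}" "u \<notin> W'"
      using leaf(2) sym[OF leaf(4)] noloop[of u] by (auto simp: N_def W'_def)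
    have W_eq: "?W = insert u (N \<union> W')" using N leaf(3) by (auto simp: W'_def)
    define \<beta> where "\<beta> = var_prod W'"
    have keys_\<beta>: "Poly_Mapping.keys \<beta> = W'" using W' by (simp add: \<beta>_def)
    have basis_\<beta>: "basis_set G \<beta> S \<longleftrightarrow> S \<subseteq> W' \<and> independent_verts G (W' - S)" for S
      unfolding basis_set_def keys_\<beta> unfolding \<beta>_def using W' finite_subset[OF _ W'(2)]
      by (auto simp: var_prod_diff)
    \<comment> \<open>The monomial belonging to the union of N and S is x_u times the one belonging
      to S, and u has no neighbour in W'.\<close>
    have lift_basis: "basis_set G \<alpha> (N \<union> S)" if "basis_set G \<beta> S" for S
    proof -
      have "?W - (N \<union> S) \<subseteq> insert u (W' - S)" unfolding W_eq by auto
      moreover have "(u, a) \<notin> parcs G \<and> (a, u) \<notin> parcs G" if "a \<in> W'" for a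
        using that sym[of a u] by (auto simp: W'_def N_def)
      moreover have "N \<union> S \<subseteq> ?W" "independent_verts G (W' - S)"
        using that N(1) W'(1) by (auto simp: basis_\<beta>)
      ultimately show ?thesis using noloop[of u] unfolding basis
        by (blast intro: independent_verts_insert)
    qed
    have basis_no_u: "N \<subseteq> U \<and> U - N \<subseteq> W' \<and> basis_set G \<beta> (U - N)" if U: "basis_set G \<alpha> U" "u \<notin> U" for U
    proof -
      have UW: "U \<subseteq> ?W" and ind: "independent_verts G (?W - U)" using U basis by auto
      have NU: "N \<subseteq> U" using ind leaf(3) U(2) by (auto simp: N_def independent_verts_def)
      have UN: "U - N \<subseteq> W'" using UW U(2) by (auto simp: W'_def)
      have "W' - (U - N) \<subseteq> ?W - U" using W' by auto
      with NU UN ind show ?thesis by (auto simp: basis_\<beta> intro: independent_verts_subset)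
    qed
    \<comment> \<open>The sign cancels the one in the product of dx_N and dx_S, so that x_u dx_N
      times the chain of d is the chain of c'.\<close>
    define d where "d = (\<lambda>S. ksign N S * c' (N \<union> S))"
    have d_cyc: "kdiff (Poly_Mapping.keys \<beta>) (\<lambda>_. 1) d U = 0" if U: "basis_set G \<beta> U" for U
    proof -
      have finU: "finite U" and UW: "U \<subseteq> W'" using basis_set_finite[OF U] U by (auto simp: basis_\<beta>)
      have NU: "basis_set G \<alpha> (N \<union> U)" by (rule lift_basis[OF U])
      have u: "u \<in> ?W - (N \<union> U)" using leaf(3) N(4) UW W'(4) by auto
      \<comment> \<open>In the cycle condition for c' at the union of N and U, the term at u
        vanishes. The remaining terms form the differential of d at U up to the global sign
        \<open>ksign N U * (- 1) ^ card N\<close>, the second factor coming from moving dx_w past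
        dx_N.\<close>
      have "?W - (N \<union> U) = insert u (W' - U)" using u UW W' by (auto simp: W_eq)
      moreover have "c' (insert u (N \<union> U)) = 0"
        using basis_set_insert[OF NU leaf(3)] by (intro c'_u) auto
      ultimately have "kdiff ?W (\<lambda>_. 1) c' (N \<union> U) =
          (\<Sum>w\<in>W' - U. ksign {w} (N \<union> U) * c' (insert w (N \<union> U)))"
        unfolding kdiff_def using W' by simp
      then have zero: "(\<Sum>w\<in>W' - U. ksign {w} (N \<union> U) * c' (insert w (N \<union> U))) = 0"
        using c'_cyc[OF NU] by simp
      have "kdiff W' (\<lambda>_. 1) d U = (\<Sum>w\<in>W' - U. (ksign N U * (- 1) ^ card N) *
          (ksign {w} (N \<union> U) * c' (insert w (N \<union> U))))"
        unfolding kdiff_def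
      proof (rule sum.cong[OF refl])
        fix w assume w: "w \<in> W' - U"
        then have wN: "w \<notin> N" "w \<notin> U" "N \<inter> U = {}" using W'(3) UW by auto
        have s: "((- 1) ^ card N :: 'k) = ksign N {w} * ksign {w} N"
          by (simp add: ksign_swap_singleton[OF N(2) wN(1)])
        have "d (insert w U) = ksign N {w} * ksign N U * c' (insert w (N \<union> U))"
          by (simp add: d_def ksign_insert_right[OF N(2) finU wN(2)])
        moreover have "ksign {w} (N \<union> U) = (ksign {w} N * ksign {w} U :: 'k)"
          using N finU wN by (intro ksign_Un_right) auto
        ultimately show "ksign {w} U * (1 * d (insert w U)) = (ksign N U * (- 1) ^ card N) *
            (ksign {w} (N \<union> U) * c' (insert w (N \<union> U)))"
          unfolding s by (simp add: mult_ac)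
      qed
      also have "\<dots> = 0" by (simp add: zero flip: sum_distrib_left)
      finally show ?thesis by (simp add: keys_\<beta>)
    qed
    have "card W' < card ?W"
      using W' leaf(3) by (intro psubset_card_mono) auto
    then have "homogeneous_chain G \<beta> d \<in> koszul_gen G"
      using less.hyps[of \<beta> d] d_cyc W'(1) \<alpha> by (simp add: keys_\<beta>)
    moreover have "(\<lambda>S. if S = N then mpoly_var u else 0) \<in> koszul_gen G"
      using leaf(3) \<alpha> N(3) by (intro koszul_gen.star) (auto simp: N_def)
    ultimately have prod: "kmul (\<lambda>S. if S = N then mpoly_var u else 0) (homogeneous_chain G \<beta> d) \<in> koszul_gen G"
      by (intro koszul_gen.mult)
    have "homogeneous_chain G \<alpha> c' U = kmul (\<lambda>S. if S = N then mpoly_var u else 0) (homogeneous_chain G \<beta> d) U"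
      if U: "U \<subseteq> pverts G" for U
    proof -
      have finU: "finite U" using U pair_finite_verts finite_subset by blast
      have k: "kmul (\<lambda>S. if S = N then mpoly_var u else 0) (homogeneous_chain G \<beta> d) U =
          (if N \<subseteq> U \<and> basis_set G \<beta> (U - N)
           then ksign N (U - N) * (mpoly_var u * Poly_Mapping.single (\<beta> - var_prod (U - N)) (d (U - N))) else 0)"
        by (simp add: kmul_star[OF finU] homogeneous_chain_def)
      show ?thesis
      proof (cases "N \<subseteq> U \<and> basis_set G \<beta> (U - N)")
        case True
        then have UN: "N \<union> (U - N) = U" by auto
        have b: "basis_set G \<alpha> U" using lift_basis[of "U - N"] True UN by simp
        have uU: "u \<notin> U" using True W'(4) N(4) by (auto simp: basis_\<beta>)
        have "Poly_Mapping.single u 1 + (\<beta> - var_prod (U - N)) = \<alpha> - var_prod U"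
          using uU W' N finU True unfolding \<beta>_def basis_\<beta>
          by (subst \<alpha>_eq, subst W_eq, intro poly_mapping_eqI)
            (auto simp: lookup_add lookup_minus lookup_single lookup_var_prod when_def)
        then show ?thesis
          unfolding k using True b UN
          by (simp add: homogeneous_chain_def mpoly_var_def mult_single ksign_times_single d_def)
      next
        case False
        \<comment> \<open>If U contains u, the coefficient is 0 by the choice of c'; if not, U is
          not a basis set, since a basis set without u consists of N and a basis set for
          \<beta>.\<close>
        then have "homogeneous_chain G \<alpha> c' U = 0"
          using basis_no_u[of U] c'_u[of U] by (cases "u \<in> U") (auto simp: homogeneous_chain_def)
        then show ?thesis unfolding k using False by (simp only: if_False)
      qed
    qed
    then have "homogeneous_chain G \<alpha> c' \<in> koszul_gen G"
      \<comment> \<open>The two chains are known to agree on subsets of the vertex set; closure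
        under \<open>homologous\<close> with boundary 0 turns this into membership.\<close>
      by (intro koszul_gen.homologous[OF prod _ homogeneous_chain_poly_chains[OF \<alpha>], where h = "\<lambda>_. 0"])
        (simp_all add: edge_ideal_closed[OF G] mpoly_ring_closed poly_chains_def)
    then show ?thesis
      by (rule koszul_gen_homogeneous[OF G \<alpha>, where g = "contr v {u}"]) (simp add: c'_def)
  qed
qed

text \<open>A cycle is split into multihomogeneous parts, each of which is a cycle. Their sum
  differs from f only in monomials with dependent support, that is, by elements of the edge
  ideal.\<close>

lemma cycle_in_koszul_gen:
  fixes f :: "'v::linorder set \<Rightarrow> ('v, 'k::comm_ring_1) mpoly"
  assumes G: "pair_graph G"
    and leaf: "\<And>W. W \<subseteq> pverts G \<Longrightarrow> W \<noteq> {} \<Longrightarrow>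
      \<exists>v\<in>W. \<forall>a\<in>W. \<forall>b\<in>W. (v, a) \<in> parcs G \<longrightarrow> (v, b) \<in> parcs G \<longrightarrow> a = b"
    and f: "f \<in> poly_chains (pverts G)"
    and cyc: "\<And>U. U \<subseteq> pverts G \<Longrightarrow> kdiff (pverts G) mpoly_var f U \<in> edge_ideal G"
  shows "f \<in> koszul_gen G"
proof -
  interpret pair_graph G by fact
  let ?V = "pverts G"
  have finV: "finite S" if "S \<subseteq> ?V" for S using that pair_finite_verts finite_subset by blast
  \<comment> \<open>The multidegrees of all terms of f: a monomial m at dx_S has multidegree
    \<open>m + var_prod S\<close>.\<close>
  define A where "A = (\<Union>S\<in>Pow ?V. (\<lambda>m. m + var_prod S) ` Poly_Mapping.keys (f S))"
  have finA: "finite A" unfolding A_def using pair_finite_verts by auto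
  have A: "Poly_Mapping.keys \<alpha> \<subseteq> ?V" if "\<alpha> \<in> A" for \<alpha>
  proof -
    obtain S m where Sm: "S \<subseteq> ?V" "m \<in> Poly_Mapping.keys (f S)" "\<alpha> = m + var_prod S"
      using \<open>\<alpha> \<in> A\<close> by (auto simp: A_def)
    then have "Poly_Mapping.keys m \<subseteq> ?V"
      using f by (auto simp: poly_chains_def in_mpoly_ring_iff)
    with Sm finV[OF Sm(1)] show ?thesis by (simp add: keys_add_nat)
  qed
  define c where "c \<alpha> S = Poly_Mapping.lookup (f S) (\<alpha> - var_prod S)" for \<alpha> S
  have c_cyc: "kdiff (Poly_Mapping.keys \<alpha>) (\<lambda>_. 1) (c \<alpha>) U = 0"
    if \<alpha>: "\<alpha> \<in> A" and U: "basis_set G \<alpha> U" for \<alpha> U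
  proof -
    let ?m = "\<alpha> - var_prod U"
    have finU: "finite U" and UV: "U \<subseteq> ?V" and UA: "U \<subseteq> Poly_Mapping.keys \<alpha>"
      using basis_set_finite[OF U] U A[OF \<alpha>] by (auto simp: basis_set_def)
    \<comment> \<open>This monomial has independent support and cannot occur in an element of the
      ideal. Its coefficient in the boundary of f is the differential of \<open>c \<alpha>\<close>
      at U.\<close>
    have "?m \<notin> Poly_Mapping.keys (kdiff ?V mpoly_var f U)"
      using cyc[OF UV] U unfolding edge_ideal_iff[OF G] basis_set_def by blast
    then have "0 = Poly_Mapping.lookup (kdiff ?V mpoly_var f U) ?m"
      by (simp add: in_keys_iff)
    also have "\<dots> = (\<Sum>v\<in>?V - U. ksign {v} U * (if v \<in> Poly_Mapping.keys ?m
        then Poly_Mapping.lookup (f (insert v U)) (?m - Poly_Mapping.single v 1) else 0))"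
      unfolding kdiff_def lookup_sum lookup_ksign_times lookup_mpoly_var_times ..
    also have "\<dots> = (\<Sum>v\<in>Poly_Mapping.keys \<alpha> - U. ksign {v} U * (1 * c \<alpha> (insert v U)))"
    proof (rule sum.mono_neutral_cong_right)
      fix v assume v: "v \<in> Poly_Mapping.keys \<alpha> - U"
      then have "v \<in> Poly_Mapping.keys ?m" using finU by (simp add: keys_diff_var_prod)
      moreover have "?m - Poly_Mapping.single v 1 = \<alpha> - var_prod (insert v U)"
        using v finU
        by (intro poly_mapping_eqI) (auto simp: lookup_minus lookup_single lookup_var_prod when_def)
      ultimately show "ksign {v} U * (if v \<in> Poly_Mapping.keys ?m
          then Poly_Mapping.lookup (f (insert v U)) (?m - Poly_Mapping.single v 1) else 0) =
          ksign {v} U * (1 * c \<alpha> (insert v U))"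
        by (simp add: c_def)
    qed (use finU A[OF \<alpha>] pair_finite_verts in \<open>auto simp: keys_diff_var_prod\<close>)
    finally show ?thesis by (simp add: kdiff_def)
  qed
  have gen: "(\<lambda>S. \<Sum>\<alpha>\<in>A. homogeneous_chain G \<alpha> (c \<alpha>) S) \<in> koszul_gen G"
    using homogeneous_cycle_in_koszul_gen[OF G leaf A c_cyc] by (intro koszul_gen_sum finA) blast
  show ?thesis
  proof (rule koszul_gen.homologous[OF gen, where h = "\<lambda>_. 0"])
    fix S assume S: "S \<subseteq> ?V"
    let ?D = "f S - (\<Sum>\<alpha>\<in>A. homogeneous_chain G \<alpha> (c \<alpha>) S)"
    have carr: "?D \<in> carrier (mpoly_ring ?V)"
    proof (intro mpoly_ring_closed mpoly_ring_sum_closed)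
      show "f S \<in> carrier (mpoly_ring ?V)" using f S by (simp add: poly_chains_def)
      show "homogeneous_chain G \<alpha> (c \<alpha>) S \<in> carrier (mpoly_ring ?V)" if "\<alpha> \<in> A" for \<alpha>
        using homogeneous_chain_poly_chains[OF A[OF that]] S by (auto simp: poly_chains_def)
    qed
    have "Poly_Mapping.lookup ?D m = 0" if m: "independent_verts G (Poly_Mapping.keys m)" for m
    proof -
      \<comment> \<open>For fixed S the monomial m determines the multidegree, so at most one
        summand contributes to its coefficient.\<close>
      have eq: "\<alpha> = m + var_prod S" if "basis_set G \<alpha> S" "\<alpha> - var_prod S = m" for \<alpha>
        using that finV[OF S] unfolding that(2)[symmetric] basis_set_def
        by (intro poly_mapping_eqI) (auto simp: lookup_add lookup_minus lookup_var_prod in_keys_iff)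
      have basis: "basis_set G (m + var_prod S) S"
        using m finV[OF S] by (auto simp: basis_set_def keys_add_nat)
      have "Poly_Mapping.lookup (homogeneous_chain G \<alpha> (c \<alpha>) S) m =
          (if \<alpha> = m + var_prod S then Poly_Mapping.lookup (f S) m else 0)" for \<alpha>
      proof (cases "\<alpha> = m + var_prod S")
        case True
        then show ?thesis using basis by (simp add: homogeneous_chain_def c_def)
      next
        case False
        with eq[of \<alpha>] show ?thesis by (auto simp: homogeneous_chain_def lookup_single when_def)
      qed
      then have "Poly_Mapping.lookup ?D m = Poly_Mapping.lookup (f S) m -
          (if m + var_prod S \<in> A then Poly_Mapping.lookup (f S) m else 0)"
        using finA by (simp add: lookup_minus lookup_sum)
      moreover have "m + var_prod S \<in> A" if "Poly_Mapping.lookup (f S) m \<noteq> 0"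
        using that S unfolding A_def by (intro UN_I[of S] imageI) (auto simp: in_keys_iff)
      ultimately show ?thesis by auto
    qed
    then show "f S - (\<Sum>\<alpha>\<in>A. homogeneous_chain G \<alpha> (c \<alpha>) S) - kdiff ?V mpoly_var (\<lambda>_. 0) S \<in> edge_ideal G"
      using carr unfolding edge_ideal_iff[OF G] in_mpoly_ring_iff by (simp add: in_keys_iff) blast
  qed (use f in \<open>auto simp: poly_chains_def mpoly_ring_closed\<close>)
qed

section \<open>Homology classes of polynomial cycles\<close>

text \<open>The \<open>itself\<close> parameter fixes the coefficient ring, which the graph alone
  does not determine.\<close>

locale edge_koszul = pair_graph G for G :: "'v::linorder pair_pre_digraph" +
  fixes coeff_type :: "'k::comm_ring_1 itself"
begin

abbreviation "V \<equiv> pverts G"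
abbreviation "cl \<equiv> edge_class G :: ('v, 'k) mpoly \<Rightarrow> ('v, 'k) mpoly set"
abbreviation "Q \<equiv> mpoly_ring V :: ('v, 'k) mpoly ring"
abbreviation "R \<equiv> edge_ring G :: ('v, 'k) mpoly set ring"
abbreviation "K \<equiv> koszul_algebra R V"
abbreviation "x \<equiv> \<lambda>v. cl (mpoly_var v)"
abbreviation "I \<equiv> edge_ideal G :: ('v, 'k) mpoly set"
abbreviation "H \<equiv> edge_koszul_homology G :: ('v set \<Rightarrow> ('v, 'k) mpoly set) set ring"
abbreviation mpoly_kdiff (\<open>\<partial>\<close>) where "\<partial> \<equiv> kdiff V (mpoly_var :: 'v \<Rightarrow> ('v, 'k) mpoly)"
abbreviation "C \<equiv> poly_chains V :: ('v set \<Rightarrow> ('v, 'k) mpoly) set"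

section \<open>The quotient map to the edge ring\<close>

lemma G: "pair_graph G"
  by (rule pair_graph_axioms)

lemmas ideal_closed = edge_ideal_closed[OF G]

lemma finite_subset_V: "S \<subseteq> V \<Longrightarrow> finite S"
  using pair_finite_verts finite_subset by blast

lemma cl_hom: "ring_hom_cring Q R cl"
  using ideal.rcos_ring_hom_cring[OF edge_ideal_ideal[OF G] mpoly_ring_cring]
  unfolding edge_ring_def edge_class_def .

lemma R_cring: "cring R"
  using cl_hom by (rule ring_hom_cring.axioms(2))

lemma cl_closed: "p \<in> carrier Q \<Longrightarrow> cl p \<in> carrier R"
  using ring_hom_memE(1)[OF ring_hom_cring.homh[OF cl_hom]] .

lemma cl_add: "p \<in> carrier Q \<Longrightarrow> q \<in> carrier Q \<Longrightarrow> cl p \<oplus>\<^bsub>R\<^esub> cl q = cl (p + q)"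
  using ring_hom_memE(3)[OF ring_hom_cring.homh[OF cl_hom], of p q] by simp

lemma cl_mult: "p \<in> carrier Q \<Longrightarrow> q \<in> carrier Q \<Longrightarrow> cl p \<otimes>\<^bsub>R\<^esub> cl q = cl (p * q)"
  using ring_hom_memE(2)[OF ring_hom_cring.homh[OF cl_hom], of p q] by simp

lemma cl_one: "\<one>\<^bsub>R\<^esub> = cl 1"
  using ring_hom_memE(4)[OF ring_hom_cring.homh[OF cl_hom]] by simp

lemma cl_zero: "\<zero>\<^bsub>R\<^esub> = cl 0"
proof -
  interpret ring_hom_cring Q R cl by (rule cl_hom)
  show ?thesis using hom_zero by simp
qed

lemma cl_uminus: "p \<in> carrier Q \<Longrightarrow> \<ominus>\<^bsub>R\<^esub> cl p = cl (- p)"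
proof -
  interpret ring_hom_cring Q R cl by (rule cl_hom)
  show "p \<in> carrier Q \<Longrightarrow> ?thesis" using hom_a_inv[of p] by simp
qed

lemma carrier_R: "carrier R = cl ` carrier Q"
  by (auto simp: edge_ring_def FactRing_def A_RCOSETS_def' edge_class_def)

lemma cl_eq_iff:
  assumes "p \<in> carrier Q" "q \<in> carrier Q"
  shows "cl p = cl q \<longleftrightarrow> p - q \<in> I"
proof -
  have cl: "cl r = (\<lambda>i. i + r) ` I" for r :: "('v, 'k) mpoly"
    by (auto simp: edge_class_def a_r_coset_def')
  have sub: "cl r \<subseteq> cl s" if "r - s \<in> I" for r s :: "('v, 'k) mpoly"
  proof
    fix y assume "y \<in> cl r"
    then obtain i where i: "i \<in> I" "y = i + r" by (auto simp: cl)
    then have "y = (i + (r - s)) + s" "i + (r - s) \<in> I" using that ideal_closed(3) by auto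
    then show "y \<in> cl s" unfolding cl by blast
  qed
  show ?thesis
  proof
    assume "cl p = cl q"
    moreover have "p \<in> cl p" unfolding cl using ideal_closed(1) by force
    ultimately obtain i where "i \<in> I" "p = i + q" by (auto simp: cl)
    then show "p - q \<in> I" by simp
  next
    assume *: "p - q \<in> I"
    then have "q - p \<in> I" using ideal_closed(2)[OF *] by simp
    with * show "cl p = cl q" using sub by blast
  qed
qed

lemma finsum_cl:
  assumes "finite A" "\<And>a. a \<in> A \<Longrightarrow> f a \<in> carrier Q"
  shows "finsum R (\<lambda>a. cl (f a)) A = cl (sum f A)"
proof -
  interpret R: cring R by (rule R_cring)
  show ?thesis using assms
  proof (induction A rule: finite_induct)
    case (insert a A)
    then have "finsum R (\<lambda>a. cl (f a)) (insert a A) = cl (f a) \<oplus>\<^bsub>R\<^esub> finsum R (\<lambda>a. cl (f a)) A"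
      by (intro R.finsum_insert) (auto intro: cl_closed)
    also have "\<dots> = cl (sum f (insert a A))"
      using insert by (simp add: cl_add mpoly_ring_sum_closed)
    finally show ?case .
  qed (simp add: cl_zero)
qed

lemma koszul_sign_cl: "koszul_sign R S T = cl (ksign S T)"
proof -
  interpret ring_hom_cring Q R cl by (rule cl_hom)
  have "(- 1) ^ n \<in> carrier Q" for n
    by (simp add: minus_one_power_iff mpoly_ring_closed)
  then have "(\<ominus>\<^bsub>R\<^esub> \<one>\<^bsub>R\<^esub>) [^]\<^bsub>R\<^esub> n = cl ((- 1) ^ n)" for n :: nat
    by (induction n) (simp_all add: cl_one cl_uminus cl_mult mpoly_ring_closed)
  then show ?thesis by (simp add: koszul_sign_def ksign_def)
qed

section \<open>The Koszul complex over the edge ring in terms of polynomial chains\<close>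

lemma C_closed: "f \<in> C \<Longrightarrow> S \<subseteq> V \<Longrightarrow> f S \<in> carrier Q"
  by (simp add: poly_chains_def)

lemma C_add: "f \<in> C \<Longrightarrow> g \<in> C \<Longrightarrow> (\<lambda>S. f S + g S) \<in> C"
  and C_uminus: "f \<in> C \<Longrightarrow> (\<lambda>S. - f S) \<in> C"
  and C_zero: "(\<lambda>S. 0) \<in> C"
  by (auto simp: poly_chains_def intro: mpoly_ring_closed)

lemma C_scalar: "(\<lambda>S. if S = {} then mpoly_const c else 0) \<in> C"
  by (auto simp: poly_chains_def intro: mpoly_ring_closed)

lemma C_bar: "f \<in> C \<Longrightarrow> (\<lambda>S. (- 1) ^ card S * f S) \<in> C"
  unfolding poly_chains_def
  by (auto simp: minus_one_power_iff intro: mpoly_ring_closed)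

lemmas C_kdiff = kdiff_poly_chains[of _ V]
lemmas C_kmul = kmul_poly_chains[of _ V]

definition chain_class :: "('v set \<Rightarrow> ('v, 'k) mpoly) \<Rightarrow> 'v set \<Rightarrow> ('v, 'k) mpoly set" where
  "chain_class f = (\<lambda>U\<in>Pow V. cl (f U))"

lemma chain_class_eqI:
  assumes "f \<in> C" "g \<in> C" "\<And>S. S \<subseteq> V \<Longrightarrow> f S - g S \<in> I"
  shows "chain_class f = chain_class g"
  unfolding chain_class_def using assms
  by (intro restrict_ext) (simp add: cl_eq_iff C_closed)

text \<open>Representatives can be chosen coefficient by coefficient, so operations on the Koszul
  complex can be computed on polynomial chains.\<close>

lemma carrier_K: "carrier K = chain_class ` C"
proof
  show "chain_class ` C \<subseteq> carrier K"
    by (simp add: image_subset_iff chain_class_def koszul_algebra_def restrict_PiE_iff cl_closed C_closed)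
  show "carrier K \<subseteq> chain_class ` C"
  proof
    fix k assume k: "k \<in> carrier K"
    then have "\<forall>S. S \<subseteq> V \<longrightarrow> (\<exists>p. p \<in> carrier Q \<and> k S = cl p)"
      by (simp add: koszul_algebra_def carrier_R PiE_iff image_iff) blast
    then obtain f where f: "\<And>S. S \<subseteq> V \<Longrightarrow> f S \<in> carrier Q \<and> k S = cl (f S)" by metis
    have "k = chain_class f"
      using k f by (auto simp: chain_class_def koszul_algebra_def fun_eq_iff PiE_def extensional_def)
    then show "k \<in> chain_class ` C" using f by (auto simp: poly_chains_def)
  qed
qed

lemma chain_class_add:
  "f \<in> C \<Longrightarrow> g \<in> C \<Longrightarrow> chain_class f \<oplus>\<^bsub>K\<^esub> chain_class g = chain_class (\<lambda>S. f S + g S)"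
  by (auto simp: koszul_algebra_def chain_class_def cl_add C_closed intro!: restrict_ext)

lemma chain_class_const:
  "koszul_const R V (cl p) = chain_class (\<lambda>S. if S = {} then p else 0)"
  unfolding koszul_const_def chain_class_def by (intro restrict_ext) (simp add: cl_zero)

lemma chain_class_zero: "\<zero>\<^bsub>K\<^esub> = chain_class (\<lambda>S. 0)"
  by (simp add: koszul_algebra_def cl_zero chain_class_const)

lemma chain_class_one: "\<one>\<^bsub>K\<^esub> = chain_class (\<lambda>S. if S = {} then 1 else 0)"
  by (simp add: koszul_algebra_def cl_one chain_class_const)

lemma chain_class_mult:
  assumes f: "f \<in> C" and g: "g \<in> C"
  shows "chain_class f \<otimes>\<^bsub>K\<^esub> chain_class g = chain_class (kmul f g)"
proof -
  interpret R: cring R by (rule R_cring)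
  have "(\<Oplus>\<^bsub>R\<^esub>S\<in>Pow U. koszul_sign R S (U - S) \<otimes>\<^bsub>R\<^esub> (chain_class f S \<otimes>\<^bsub>R\<^esub> chain_class g (U - S))) =
      cl (kmul f g U)" if U: "U \<subseteq> V" for U
  proof -
    have mem: "f S \<in> carrier Q" "g (U - S) \<in> carrier Q" if "S \<in> Pow U" for S
      using that U by (auto intro!: C_closed[OF f] C_closed[OF g])
    have "(\<Oplus>\<^bsub>R\<^esub>S\<in>Pow U. koszul_sign R S (U - S) \<otimes>\<^bsub>R\<^esub> (chain_class f S \<otimes>\<^bsub>R\<^esub> chain_class g (U - S))) =
        (\<Oplus>\<^bsub>R\<^esub>S\<in>Pow U. cl (ksign S (U - S) * (f S * g (U - S))))"
    proof (rule R.finsum_cong'[OF refl])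
      fix S assume S: "S \<in> Pow U"
      then have "chain_class f S = cl (f S)" "chain_class g (U - S) = cl (g (U - S))"
        using U by (auto simp: chain_class_def)
      then show "koszul_sign R S (U - S) \<otimes>\<^bsub>R\<^esub> (chain_class f S \<otimes>\<^bsub>R\<^esub> chain_class g (U - S)) =
          cl (ksign S (U - S) * (f S * g (U - S)))"
        using mem[OF S] by (simp add: koszul_sign_cl cl_mult ksign_mpoly_closed mpoly_ring_closed)
    qed (use mem in \<open>auto intro!: cl_closed mpoly_ring_closed ksign_mpoly_closed\<close>)
    also have "\<dots> = cl (kmul f g U)"
      unfolding kmul_def using finite_subset_V[OF U] mem
      by (intro finsum_cl) (auto intro!: mpoly_ring_closed ksign_mpoly_closed)
    finally show ?thesis .
  qed
  then show ?thesis
    by (auto simp: koszul_algebra_def chain_class_def[of "kmul f g"] intro!: restrict_ext)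
qed

lemma chain_class_diff:
  assumes f: "f \<in> C"
  shows "koszul_diff R V x (chain_class f) = chain_class (\<partial> f)"
proof -
  interpret R: cring R by (rule R_cring)
  have "(\<Oplus>\<^bsub>R\<^esub>v\<in>V - U. koszul_sign R {v} U \<otimes>\<^bsub>R\<^esub> (x v \<otimes>\<^bsub>R\<^esub> chain_class f (insert v U))) = cl (\<partial> f U)"
    if U: "U \<subseteq> V" for U
  proof -
    have mem: "f (insert v U) \<in> carrier Q" if "v \<in> V - U" for v
      using that U by (auto intro!: C_closed[OF f])
    have "(\<Oplus>\<^bsub>R\<^esub>v\<in>V - U. koszul_sign R {v} U \<otimes>\<^bsub>R\<^esub> (x v \<otimes>\<^bsub>R\<^esub> chain_class f (insert v U))) =
        (\<Oplus>\<^bsub>R\<^esub>v\<in>V - U. cl (ksign {v} U * (mpoly_var v * f (insert v U))))"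
    proof (rule R.finsum_cong'[OF refl])
      fix v assume v: "v \<in> V - U"
      then have "chain_class f (insert v U) = cl (f (insert v U))"
        using U by (auto simp: chain_class_def)
      then show "koszul_sign R {v} U \<otimes>\<^bsub>R\<^esub> (x v \<otimes>\<^bsub>R\<^esub> chain_class f (insert v U)) =
          cl (ksign {v} U * (mpoly_var v * f (insert v U)))"
        using mem[OF v] v by (simp add: koszul_sign_cl cl_mult ksign_mpoly_closed mpoly_ring_closed)
    qed (use mem in \<open>auto intro!: cl_closed mpoly_ring_closed ksign_mpoly_closed\<close>)
    also have "\<dots> = cl (\<partial> f U)"
      unfolding kdiff_def using pair_finite_verts mem
      by (intro finsum_cl) (auto intro!: mpoly_ring_closed ksign_mpoly_closed)
    finally show ?thesis .
  qed
  then show ?thesis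
    by (auto simp: koszul_diff_def chain_class_def[of "\<partial> f"] intro!: restrict_ext)
qed

section \<open>Polynomial cycles modulo the ideal and their homology classes\<close>

definition Z :: "('v set \<Rightarrow> ('v, 'k) mpoly) set" where
  "Z = {f \<in> C. \<forall>U\<subseteq>V. \<partial> f U \<in> I}"

lemma Z_C: "f \<in> Z \<Longrightarrow> f \<in> C"
  by (simp add: Z_def)

lemma chain_class_cycle_iff:
  "f \<in> C \<Longrightarrow> koszul_diff R V x (chain_class f) = \<zero>\<^bsub>K\<^esub> \<longleftrightarrow> f \<in> Z"
proof -
  assume f: "f \<in> C"
  have "chain_class (\<partial> f) = chain_class (\<lambda>S. 0) \<longleftrightarrow> (\<forall>U\<subseteq>V. cl (\<partial> f U) = cl 0)"
    by (auto simp: chain_class_def fun_eq_iff restrict_def)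
  also have "\<dots> \<longleftrightarrow> (\<forall>U\<subseteq>V. \<partial> f U \<in> I)"
    using C_closed[OF C_kdiff[OF f]] by (auto simp: cl_eq_iff mpoly_ring_closed)
  finally show ?thesis using f by (simp add: chain_class_diff chain_class_zero Z_def)
qed

lemma cycles_eq: "koszul_cycles R V x = chain_class ` Z"
  unfolding koszul_cycles_def carrier_K using chain_class_cycle_iff Z_C by blast

lemma boundaries_eq: "koszul_boundaries R V x = (\<lambda>h. chain_class (\<partial> h)) ` C"
  unfolding koszul_boundaries_def carrier_K image_image
  by (intro image_cong refl chain_class_diff)

definition homology_class :: "('v set \<Rightarrow> ('v, 'k) mpoly) \<Rightarrow> ('v set \<Rightarrow> ('v, 'k) mpoly set) set" where
  "homology_class f = koszul_class R V x (chain_class f)"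

lemma homology_class_eq:
  assumes "f \<in> C"
  shows "homology_class f = (\<lambda>h. chain_class (\<lambda>S. \<partial> h S + f S)) ` C"
  unfolding homology_class_def koszul_class_def boundaries_eq a_r_coset_def'
  using assms by (auto simp: chain_class_add C_kdiff)

text \<open>A boundary added to a representative is absorbed by the coset, with
  \<open>h' + h\<close> as new witness. The reverse inclusion follows by negating h.\<close>

lemma homology_class_subset:
  assumes f: "f \<in> C" and g: "g \<in> C" and h: "h \<in> C"
    and eq: "\<And>S. S \<subseteq> V \<Longrightarrow> f S - g S - \<partial> h S \<in> I"
  shows "homology_class f \<subseteq> homology_class g"
proof
  fix k assume "k \<in> homology_class f"
  then obtain h' where h': "h' \<in> C" "k = chain_class (\<lambda>S. \<partial> h' S + f S)"
    using f by (auto simp: homology_class_eq)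
  have "k = chain_class (\<lambda>S. \<partial> (\<lambda>S. h' S + h S) S + g S)"
    unfolding h'(2)
  proof (rule chain_class_eqI)
    fix S assume "S \<subseteq> V"
    from eq[OF this] show "\<partial> h' S + f S - (\<partial> (\<lambda>S. h' S + h S) S + g S) \<in> I"
      by (simp add: kdiff_add algebra_simps)
  qed (intro C_add C_kdiff f g h h'(1))+
  then show "k \<in> homology_class g"
    using C_add[OF h'(1) h] g by (auto simp: homology_class_eq)
qed

lemma homology_class_eqI:
  assumes f: "f \<in> C" and g: "g \<in> C" and h: "h \<in> C"
    and eq: "\<And>S. S \<subseteq> V \<Longrightarrow> f S - g S - \<partial> h S \<in> I"
  shows "homology_class f = homology_class g"
proof
  show "homology_class f \<subseteq> homology_class g" by (rule homology_class_subset[OF assms])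
  show "homology_class g \<subseteq> homology_class f"
  proof (rule homology_class_subset[OF g f C_uminus[OF h]])
    fix S assume "S \<subseteq> V"
    from ideal_closed(2)[OF eq[OF this]] show "g S - f S - \<partial> (\<lambda>S. - h S) S \<in> I"
      by (simp add: kdiff_minus algebra_simps)
  qed
qed

lemma Z_add: "f \<in> Z \<Longrightarrow> g \<in> Z \<Longrightarrow> (\<lambda>S. f S + g S) \<in> Z"
  by (auto simp: Z_def C_add kdiff_add intro: ideal_closed)

lemma Z_uminus: "f \<in> Z \<Longrightarrow> (\<lambda>S. - f S) \<in> Z"
  by (auto simp: Z_def C_uminus kdiff_minus intro: ideal_closed)

lemma Z_zero: "(\<lambda>S. 0) \<in> Z"
  by (auto simp: Z_def C_zero intro: ideal_closed)

lemma Z_scalar: "(\<lambda>S. if S = {} then mpoly_const c else 0) \<in> Z"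
  by (auto simp: Z_def C_scalar kdiff_def intro: ideal_closed)

text \<open>The index set \<open>insert v U\<close> has one element more than U, whence the extra
  sign.\<close>

lemma kdiff_bar:
  "U \<subseteq> V \<Longrightarrow> \<partial> (\<lambda>S. (- 1) ^ card S * f S) U = - ((- 1) ^ card U * \<partial> f U)"
  unfolding kdiff_def sum_distrib_left sum_negf[symmetric]
  by (intro sum.cong refl) (simp add: finite_subset_V mult_ac)

lemma kmul_ideal:
  assumes U: "U \<subseteq> V" and f: "f \<in> C" and g: "g \<in> C"
    and I: "(\<forall>S\<subseteq>V. f S \<in> I) \<or> (\<forall>S\<subseteq>V. g S \<in> I)"
  shows "kmul f g U \<in> I"
  unfolding kmul_def
proof (rule edge_ideal_sum_closed[OF G])
  fix S assume S: "S \<in> Pow U"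
  then have SV: "S \<subseteq> V" "U - S \<subseteq> V" using U by auto
  from I have "f S * g (U - S) \<in> I"
    using SV C_closed[OF f] C_closed[OF g] by (auto intro: ideal_closed)
  then show "ksign S (U - S) * (f S * g (U - S)) \<in> I"
    by (rule ideal_closed(6)[OF _ ksign_mpoly_closed])
qed

lemma kdiff_ideal:
  assumes U: "U \<subseteq> V" and f: "\<And>S. S \<subseteq> V \<Longrightarrow> f S \<in> I"
  shows "\<partial> f U \<in> I"
  unfolding kdiff_def
  using U by (intro edge_ideal_sum_closed[OF G] ideal_closed(6) ksign_mpoly_closed f) auto

lemma bar_ideal: "p \<in> I \<Longrightarrow> (- 1) ^ n * p \<in> I"
  by (simp add: minus_one_power_iff ideal_closed)

lemma kdiff_kdiff_V: "U \<subseteq> V \<Longrightarrow> \<partial> (\<partial> f) U = 0"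
  by (simp add: kdiff_kdiff pair_finite_verts finite_subset_V)

lemma Z_bar: "f \<in> Z \<Longrightarrow> (\<lambda>S. (- 1) ^ card S * f S) \<in> Z"
  by (auto simp: Z_def C_bar kdiff_bar intro!: ideal_closed(2) bar_ideal)

text \<open>In each of the two Leibniz terms one factor takes values in the ideal.\<close>

lemma Z_kmul:
  assumes f: "f \<in> Z" and g: "g \<in> Z"
  shows "kmul f g \<in> Z"
  unfolding Z_def
proof (intro CollectI conjI allI impI)
  fix U assume U: "U \<subseteq> V"
  have "kmul (\<partial> f) g U \<in> I" "kmul (\<lambda>S. (- 1) ^ card S * f S) (\<partial> g) U \<in> I"
    using f g unfolding Z_def by (blast intro: kmul_ideal[OF U] C_kdiff C_bar)+
  then show "\<partial> (kmul f g) U \<in> I"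
    by (simp add: kdiff_kmul[OF pair_finite_verts U] ideal_closed)
qed (intro C_kmul Z_C f g)

text \<open>Independence of the product from the representatives, on which multiplication of cosets
  rests.\<close>

lemma homology_class_kmul:
  assumes f: "f \<in> Z" and g: "g \<in> Z" and h: "h \<in> C" and k: "k \<in> C"
  shows "homology_class (kmul (\<lambda>S. \<partial> h S + f S) (\<lambda>S. \<partial> k S + g S)) = homology_class (kmul f g)"
proof -
  note C = Z_C[OF f] Z_C[OF g] h k C_kdiff[OF h] C_kdiff[OF k]
  \<comment> \<open>By the Leibniz rule the three summands contribute the products of
    \<open>\<partial> h\<close> with g, of \<open>\<partial> h\<close> with
    \<open>\<partial> k\<close>, and of f with \<open>\<partial> k\<close>, which is the difference
    of the two products. The sign twist on f cancels the Leibniz sign; the remaining terms lie in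
    the ideal or contain \<open>\<partial> (\<partial> k)\<close>.\<close>
  define w where "w = (\<lambda>S. kmul h g S + (kmul h (\<partial> k) S + kmul (\<lambda>S. (- 1) ^ card S * f S) k S))"
  have w: "w \<in> C" unfolding w_def by (intro C_add C_kmul C_bar C)
  show ?thesis
  proof (rule homology_class_eqI[OF _ _ w])
    fix U assume U: "U \<subseteq> V"
    note leibniz = kdiff_kmul[OF pair_finite_verts U, of mpoly_var]
    have "kmul (\<lambda>S. (- 1) ^ card S * h S) (\<partial> g) U \<in> I"
      using g by (intro kmul_ideal[OF U] C_bar C_kdiff C) (auto simp: Z_def)
    moreover have "kmul (\<partial> (\<lambda>S. (- 1) ^ card S * f S)) k U \<in> I"
      using Z_bar[OF f] by (intro kmul_ideal[OF U] C_kdiff C_bar C) (auto simp: Z_def)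
    moreover have "kmul (\<lambda>S. (- 1) ^ card S * h S) (\<partial> (\<partial> k)) U = 0"
      unfolding kmul_def
    proof (intro sum.neutral ballI)
      fix S assume "S \<in> Pow U"
      then have "U - S \<subseteq> V" using U by auto
      then show "ksign S (U - S) * ((- 1) ^ card S * h S * \<partial> (\<partial> k) (U - S)) = 0"
        by (simp add: kdiff_kdiff_V)
    qed
    moreover have "kmul (\<lambda>S. (- 1) ^ card S * ((- 1) ^ card S * f S)) (\<partial> k) U = kmul f (\<partial> k) U"
      by (rule kmul_cong) (auto simp flip: mult.assoc power_mult_distrib)
    ultimately show "kmul (\<lambda>S. \<partial> h S + f S) (\<lambda>S. \<partial> k S + g S) U - kmul f g U - \<partial> w U \<in> I"
      unfolding w_def
      by (simp add: kdiff_add leibniz kmul_add_left kmul_add_right ideal_closed algebra_simps)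
  qed (intro C_kmul C_add C)+
qed

section \<open>The homology ring\<close>

lemma H_carrier: "carrier H = homology_class ` Z"
  unfolding edge_koszul_homology_def koszul_homology_def FactRing_def A_RCOSETS_def'
  by (auto simp: cycles_eq homology_class_def koszul_class_def a_r_coset_def')

lemma H_zero: "\<zero>\<^bsub>H\<^esub> = homology_class (\<lambda>S. 0)"
  by (simp add: edge_koszul_homology_def koszul_homology_def FactRing_def homology_class_eq C_zero boundaries_eq)

lemma H_one: "\<one>\<^bsub>H\<^esub> = homology_class (\<lambda>S. if S = {} then 1 else 0)"
  by (simp add: edge_koszul_homology_def koszul_homology_def FactRing_def homology_class_def
      koszul_class_def a_r_coset_def' chain_class_one)

lemma H_add:
  assumes f: "f \<in> Z" and g: "g \<in> Z"
  shows "homology_class f \<oplus>\<^bsub>H\<^esub> homology_class g = homology_class (\<lambda>S. f S + g S)"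
proof -
  note C = Z_C[OF f] Z_C[OF g]
  have "homology_class f \<oplus>\<^bsub>H\<^esub> homology_class g =
      (\<Union>a\<in>homology_class f. \<Union>b\<in>homology_class g. {a \<oplus>\<^bsub>K\<^esub> b})"
    by (simp add: edge_koszul_homology_def koszul_homology_def FactRing_def set_add_def')
  also have "\<dots> = {chain_class (\<lambda>S. \<partial> (\<lambda>S. h S + k S) S + (f S + g S)) | h k. h \<in> C \<and> k \<in> C}"
    using C by (auto simp: homology_class_eq chain_class_add C_add C_kdiff kdiff_add add_ac)
  also have "\<dots> = homology_class (\<lambda>S. f S + g S)"
    unfolding homology_class_eq[OF C_add[OF C]]
  proof (intro equalityI subsetI)
    fix y assume "y \<in> (\<lambda>h. chain_class (\<lambda>S. \<partial> h S + (f S + g S))) ` C"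
    then obtain h where "h \<in> C" "y = chain_class (\<lambda>S. \<partial> (\<lambda>S. h S + 0) S + (f S + g S))" by auto
    then show "y \<in> {chain_class (\<lambda>S. \<partial> (\<lambda>S. h S + k S) S + (f S + g S)) | h k. h \<in> C \<and> k \<in> C}"
      using C_zero by (intro CollectI exI[of _ h] exI[of _ "\<lambda>S. 0"]) simp
  qed (auto intro: C_add)
  finally show ?thesis .
qed

text \<open>The product of cosets is a union over all pairs of representatives; by
  \<open>homology_class_kmul\<close> all members of the union coincide.\<close>

lemma H_mult:
  assumes f: "f \<in> Z" and g: "g \<in> Z"
  shows "homology_class f \<otimes>\<^bsub>H\<^esub> homology_class g = homology_class (kmul f g)"
proof -
  note C = Z_C[OF f] Z_C[OF g]
  have "homology_class f \<otimes>\<^bsub>H\<^esub> homology_class g =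
      (\<Union>a\<in>homology_class f. \<Union>b\<in>homology_class g. koszul_class R V x (a \<otimes>\<^bsub>K\<^esub> b))"
    by (simp add: edge_koszul_homology_def koszul_homology_def FactRing_def rcoset_mult_def
        koszul_class_def a_r_coset_def')
  also have "\<dots> = (\<Union>h\<in>C. \<Union>k\<in>C. homology_class (kmul (\<lambda>S. \<partial> h S + f S) (\<lambda>S. \<partial> k S + g S)))"
    using C by (simp add: homology_class_eq chain_class_mult C_add C_kdiff flip: homology_class_def)
  also have "\<dots> = homology_class (kmul f g)"
    using C_zero by (auto simp: homology_class_kmul[OF f g])
  finally show ?thesis .
qed

text \<open>Makes the finite sums in the linear strand available.\<close>

lemma H_abelian_group: "abelian_group H"
proof (rule abelian_groupI)
  fix a assume "a \<in> carrier H"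
  then obtain f where f: "f \<in> Z" "a = homology_class f" by (auto simp: H_carrier)
  have "homology_class (\<lambda>S. - f S) \<oplus>\<^bsub>H\<^esub> a = \<zero>\<^bsub>H\<^esub>"
    unfolding f(2) H_add[OF Z_uminus[OF f(1)] f(1)] H_zero by simp
  then show "\<exists>b\<in>carrier H. b \<oplus>\<^bsub>H\<^esub> a = \<zero>\<^bsub>H\<^esub>"
    using Z_uminus[OF f(1)] by (auto simp: H_carrier)
qed (auto simp: H_carrier H_zero H_add Z_add Z_zero add_ac)

lemma H_mult_closed: "a \<in> carrier H \<Longrightarrow> b \<in> carrier H \<Longrightarrow> a \<otimes>\<^bsub>H\<^esub> b \<in> carrier H"
  by (auto simp: H_carrier H_mult Z_kmul)

section \<open>Scalars, linear strand and the generated subalgebra\<close>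

lemma edge_scalar_eq:
  "edge_scalar G (c::'k) = homology_class (\<lambda>S. if S = {} then mpoly_const c else 0)"
  by (simp add: edge_scalar_def homology_class_def chain_class_const)

lemma homology_part_subset: "koszul_homology_part R Rj V x i j \<subseteq> carrier H"
  unfolding koszul_homology_part_def H_carrier cycles_eq homology_class_def by auto

lemma linear_strand_subset: "edge_linear_strand G \<subseteq> carrier H"
proof -
  interpret abelian_group H by (rule H_abelian_group)
  show ?thesis
    unfolding edge_linear_strand_def linear_strand_def
    using homology_part_subset
    by (auto simp: edge_koszul_homology_def[symmetric] Pi_iff intro!: finsum_closed) blast
qed

lemma generated_subset: "generated_algebra H (edge_scalar G) (edge_linear_strand G) \<subseteq> carrier H"
proof
  interpret abelian_group H by (rule H_abelian_group)
  fix a assume "a \<in> generated_algebra H (edge_scalar G) (edge_linear_strand G)"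
  then show "a \<in> carrier H"
    unfolding generated_algebra_def
  proof (induction rule: generate_ring.induct)
    case one
    have "mpoly_const 1 = (1 :: ('v, 'k) mpoly)" by (simp add: mpoly_const_def)
    from Z_scalar[of 1, unfolded this] show ?case by (simp add: H_one H_carrier)
  next
    case (incl h)
    then show ?case using linear_strand_subset Z_scalar by (auto simp: edge_scalar_eq H_carrier)
  qed (auto intro: H_mult_closed)
qed

text \<open>Up to sign, each nonzero term of the differential is x_v x_u with v in L, and this is a
  generator of the ideal.\<close>

lemma star_cycle:
  assumes u: "u \<in> V" and L: "L \<subseteq> {w. (u, w) \<in> parcs G}"
  shows "(\<lambda>S. if S = L then mpoly_var u else 0) \<in> Z"
  unfolding Z_def
proof (intro CollectI conjI allI impI)
  show "(\<lambda>S. if S = L then mpoly_var u else 0) \<in> C"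
    using u by (auto simp: poly_chains_def intro: mpoly_ring_closed)
  fix U assume U: "U \<subseteq> V"
  show "\<partial> (\<lambda>S. if S = L then mpoly_var u else 0) U \<in> I"
    unfolding kdiff_def
  proof (rule edge_ideal_sum_closed[OF G])
    fix v assume v: "v \<in> V - U"
    have "mpoly_var v * (if insert v U = L then mpoly_var u else 0) \<in> I"
    proof (cases "insert v U = L")
      case True
      then have "(u, v) \<in> parcs G" using L by auto
      then show ?thesis
        using u v True by (simp add: edge_ideal_iff[OF G] mpoly_var_def mult_single keys_add_nat)
          (auto simp: independent_verts_def)
    qed (simp add: ideal_closed)
    then show "ksign {v} U * (mpoly_var v * (if insert v U = L then mpoly_var u else 0)) \<in> I"
      by (rule ideal_closed(6)[OF _ ksign_mpoly_closed])
  qed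
qed

text \<open>Internal degree i + 1 in homological degree i leaves degree 1 for the
  coefficients.\<close>

lemma homology_partI:
  assumes f: "f \<in> Z" and deg: "\<And>S. S \<subseteq> V \<Longrightarrow> if card S = i then f S \<in> mpoly_part V 1 else f S = 0"
  shows "homology_class f \<in> koszul_homology_part R (edge_ring_part G) V x i (i + 1)"
  unfolding koszul_homology_part_def homology_class_def
proof (intro imageI IntI)
  show "chain_class f \<in> koszul_cycles R V x" using f by (auto simp: cycles_eq)
  show "chain_class f \<in> koszul_part R (edge_ring_part G) V i (i + 1)"
    unfolding koszul_part_def
  proof (intro CollectI conjI ballI)
    show "chain_class f \<in> carrier K" using Z_C[OF f] by (auto simp: carrier_K)
    fix S assume "S \<in> Pow V"
    then show "chain_class f S \<in>
        (if card S = i \<and> i \<le> i + 1 then edge_ring_part G (i + 1 - i) else {\<zero>\<^bsub>R\<^esub>})"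
      using deg[of S] by (auto simp: chain_class_def edge_ring_part_def cl_zero)
  qed
qed

text \<open>An element of the strand is a sum over all homological degrees, so the class is written
  as such a sum with all other summands zero. Its degree \<open>card L\<close> is in range because L
  consists of vertices.\<close>

lemma star_in_linear_strand:
  assumes u: "u \<in> V" and L: "L \<subseteq> {w. (u, w) \<in> parcs G}"
  shows "homology_class (\<lambda>S. if S = L then mpoly_var u else 0) \<in> edge_linear_strand G"
proof -
  interpret abelian_group H by (rule H_abelian_group)
  let ?s = "\<lambda>S. if S = L then mpoly_var u else 0"
  define h where "h i = (if card L = i then homology_class ?s else \<zero>\<^bsub>H\<^esub>)" for i
  have LV: "L \<subseteq> V" using L in_arcsD2 by auto
  \<comment> \<open>The zero polynomial counts as homogeneous of degree 1; this covers the sets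
    other than L that have as many elements as L.\<close>
  have zero: "0 \<in> mpoly_part V 1" and var: "mpoly_var u \<in> mpoly_part V 1"
    using u by (auto simp: mpoly_part_def in_mpoly_ring_iff mpoly_var_def monomial_degree_def)
  have h: "h i \<in> koszul_homology_part R (edge_ring_part G) V x i (i + 1)" for i
  proof (cases "card L = i")
    case True
    have "homology_class ?s \<in> koszul_homology_part R (edge_ring_part G) V x i (i + 1)"
      by (rule homology_partI[OF star_cycle[OF u L]]) (use True zero var in auto)
    with True show ?thesis by (simp add: h_def)
  next
    case False
    have "homology_class (\<lambda>S. 0) \<in> koszul_homology_part R (edge_ring_part G) V x i (i + 1)"
      by (rule homology_partI[OF Z_zero]) (use zero in auto)
    with False show ?thesis by (simp add: h_def H_zero)
  qed
  have "homology_class ?s \<in> carrier H" using star_cycle[OF u L] by (simp add: H_carrier)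
  then have "(\<Oplus>\<^bsub>H\<^esub>i\<in>{..card V}. h i) = homology_class ?s"
    unfolding h_def using card_mono[OF pair_finite_verts LV]
    by (intro finsum_singleton[where f = "\<lambda>_. homology_class ?s"]) auto
  with h show ?thesis
    unfolding edge_linear_strand_def linear_strand_def edge_koszul_homology_def[symmetric]
    by (intro CollectI exI[of _ h]) (simp add: Pi_iff)
qed

text \<open>Being a cycle is carried through the induction because the formulas for sums and
  products of classes require it.\<close>

lemma koszul_gen_generated:
  assumes "f \<in> koszul_gen G"
  shows "f \<in> Z \<and> homology_class f \<in> generated_algebra H (edge_scalar G) (edge_linear_strand G)"
  using assms
proof (induction rule: koszul_gen.induct)
  case (scalar c)
  have "edge_scalar G c \<in> generated_algebra H (edge_scalar G) (edge_linear_strand G)"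
    unfolding generated_algebra_def by (intro generate_ring.incl) auto
  then show ?case by (simp add: Z_scalar edge_scalar_eq[of c, symmetric])
next
  case (star u L)
  then show ?case
    using star_cycle[of u L] star_in_linear_strand[of u L]
    unfolding generated_algebra_def by (auto intro: generate_ring.incl)
next
  case (add f g)
  then show ?case
    using generate_ring.eng_add[of "homology_class f" H _ "homology_class g"]
    by (simp add: generated_algebra_def H_add Z_add)
next
  case (mult f g)
  then show ?case
    using generate_ring.eng_mult[of "homology_class f" H _ "homology_class g"]
    by (simp add: generated_algebra_def H_mult Z_kmul)
next
  case (homologous f h f')
  have "homology_class f' = homology_class f"
    using homologous by (intro homology_class_eqI[of f' f h]) (auto simp: Z_C)
  moreover have "f' \<in> Z"
    unfolding Z_def
  proof (intro CollectI conjI allI impI)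
    fix U assume U: "U \<subseteq> V"
    \<comment> \<open>The differential preserves the ideal and kills \<open>\<partial> h\<close>, so
      f' inherits the cycle condition from f.\<close>
    have "\<partial> (\<lambda>S. f' S - f S - \<partial> h S) U \<in> I"
      by (rule kdiff_ideal[OF U]) (rule homologous(4))
    then have "\<partial> f' U - \<partial> f U \<in> I"
      using U by (simp add: kdiff_diff kdiff_kdiff_V)
    from ideal_closed(3)[OF this, of "\<partial> f U"] show "\<partial> f' U \<in> I"
      using homologous(5) U by (simp add: Z_def)
  qed (rule homologous)
  ultimately show ?case using homologous by simp
qed

end

theorem theorem4p2:
  fixes G :: "'v::linorder pair_pre_digraph"
  assumes "simple_tree G"
  shows "generated_algebra
           (edge_koszul_homology G :: ('v set \<Rightarrow> ('v, 'k::field) mpoly set) set ring)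
           (edge_scalar G) (edge_linear_strand G)
         = carrier (edge_koszul_homology G :: ('v set \<Rightarrow> ('v, 'k) mpoly set) set ring)"
proof -
  have G: "pair_graph G" using assms by (simp add: simple_tree_def)
  interpret edge_koszul G "TYPE('k)" using G by (rule edge_koszul.intro)
  have leaf: "\<exists>v\<in>W. \<forall>a\<in>W. \<forall>b\<in>W. (v, a) \<in> parcs G \<longrightarrow> (v, b) \<in> parcs G \<longrightarrow> a = b"
    if "W \<subseteq> pverts G" "W \<noteq> {}" for W
    using forest_has_leaf[OF G _ that] assms unfolding simple_tree_def by metis
  \<comment> \<open>The substantial inclusion: every class has a polynomial cycle as representative,
    and this cycle is an expression in star cycles modulo boundaries and the ideal.\<close>
  have "homology_class f \<in> generated_algebra H (edge_scalar G) (edge_linear_strand G)"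
    if "f \<in> Z" for f
    using that cycle_in_koszul_gen[OF G leaf] koszul_gen_generated by (auto simp: Z_def)
  then show ?thesis using generated_subset by (auto simp: H_carrier)
qed

end
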